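(* Let $\xi_0,\xi_1,\dots$ be a sequence of non-degenerate i.i.d. complex-valued random variables, and for $n\ge1$ let $$H_n(z)=\sum_{j=0}^n\xi_jz^j.$$ Then the normalized zero counting measure $Z_{H_n}$ converges in probability (in the weak* topology) to the uniform probability measure $\frac{1}{2\pi}d\theta$ on the unit circle $\{|z|=1\}$ if and only if $\mathbb{P}(|\xi_0|>e^{t})=o(t^{-1})$ as $t\to+\infty$.
   Context: A random variable is non-degenerate if its law is supported on at least two points. $Z_{H_n}=\frac{1}{2\pi}\Delta\left(\frac1n\log|H_n|\right)=\frac1n\sum_j\delta_{z_j}$, the sum being over the zeros of $H_n$ counted with multiplicity (set to be the zero measure on the event $H_n\equiv0$). It is a positive measure of total mass at most $1$; the weak* topology is that of testing against bounded continuous functions on $\mathbb{C}$. Convergence in probability of $Z_{H_n}$ to $\mu$ means that $\mathbb{P}(Z_{H_n}\in U)\to1$ for every weak* open set $U$ containing $\mu$. *)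

theory Defs
  imports "HOL-Probability.Probability" "HOL-Computational_Algebra.Polynomial"
begin

definition measure_support :: "'a::topological_space measure \<Rightarrow> 'a set" where
  "measure_support N = {x. \<forall>U. open U \<and> x \<in> U \<longrightarrow> emeasure N U > 0}"

definition nondegenerate :: "'w measure \<Rightarrow> ('w \<Rightarrow> 'b::topological_space) \<Rightarrow> bool" where
  "nondegenerate M X \<longleftrightarrow>
     (\<exists>x \<in> measure_support (distr M borel X). \<exists>y \<in> measure_support (distr M borel X). x \<noteq> y)"

definition random_poly :: "(nat \<Rightarrow> 'w \<Rightarrow> complex) \<Rightarrow> nat \<Rightarrow> 'w \<Rightarrow> complex poly" where
  "random_poly \<xi> n \<omega> = (\<Sum>j\<le>n. monom (\<xi> j \<omega>) j)"

text \<open>The normalization is by \<open>n\<close>, not by the degree of \<open>p\<close>; hence the total mass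
  is less than one when the leading coefficient of the random polynomial vanishes.\<close>

definition zero_counting_measure :: "nat \<Rightarrow> complex poly \<Rightarrow> complex measure" where
  "zero_counting_measure n p =
     (if p = 0 then null_measure borel
      else distr (point_measure {z. poly p z = 0} (\<lambda>z. ennreal (real (order z p) / real n)))
             borel (\<lambda>z. z))"

definition finite_borel_measures :: "'a::topological_space measure set" where
  "finite_borel_measures = {\<mu>. sets \<mu> = sets borel \<and> finite_measure \<mu>}"

text \<open>The coarsest topology on the finite positive Borel measures that makes \<open>\<mu> \<mapsto> \<integral> f d\<mu>\<close>
  continuous for each bounded continuous \<open>f\<close>. Real-valued \<open>f\<close> suffice, as complex-valued ones
  split into real and imaginary parts.\<close>

definition weak_star_topology :: "'a::topological_space measure topology" where
  "weak_star_topology = topology_generated_by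
     {{\<mu> \<in> finite_borel_measures. (\<integral>x. f x \<partial>\<mu>) \<in> V} | (f :: 'a \<Rightarrow> real) V.
        continuous_on UNIV f \<and> bounded (range f) \<and> open V}"

definition converges_in_prob ::
  "'w measure \<Rightarrow> 'b topology \<Rightarrow> (nat \<Rightarrow> 'w \<Rightarrow> 'b) \<Rightarrow> 'b \<Rightarrow> bool" where
  "converges_in_prob M T X l \<longleftrightarrow>
     (\<forall>U. openin T U \<and> l \<in> U \<longrightarrow>
        (\<lambda>n. measure M {\<omega> \<in> space M. X n \<omega> \<in> U}) \<longlonglongrightarrow> 1)"

definition circle_measure :: "complex measure" where
  "circle_measure = distr (uniform_measure lborel {0..2 * pi}) borel cis"

lemma emeasure_zero_counting_measure:
  assumes "p \<noteq> 0" "A \<in> sets borel"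
  shows "emeasure (zero_counting_measure n p) A =
           (\<Sum>z | poly p z = 0. ennreal (real (order z p) / real n) * indicator A z)"
proof -
  have fin: "finite {z. poly p z = 0}"
    using assms(1) by (rule poly_roots_finite)
  have "emeasure (zero_counting_measure n p) A =
      (\<Sum>z \<in> {z. poly p z = 0} \<inter> A. ennreal (real (order z p) / real n))"
    using assms fin
    by (simp add: zero_counting_measure_def emeasure_distr space_point_measure
        emeasure_point_measure_finite measurable_def sets_point_measure Int_commute)
  also have "\<dots> = (\<Sum>z | poly p z = 0. ennreal (real (order z p) / real n) * indicator A z)"
    using fin by (auto simp: indicator_def intro!: sum.mono_neutral_cong_left)
  finally show ?thesis .
qed

lemma topspace_weak_star:
  "topspace (weak_star_topology :: 'a::topological_space measure topology) = finite_borel_measures"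
  unfolding weak_star_topology_def topology_generated_by_topspace
proof (intro equalityI subsetI)
  fix \<mu> :: "'a measure"
  assume \<mu>: "\<mu> \<in> finite_borel_measures"
  have "{\<nu> \<in> finite_borel_measures. (\<integral>x. (0::real) \<partial>\<nu>) \<in> UNIV} \<in>
     {{\<mu> \<in> finite_borel_measures. (\<integral>x. f x \<partial>\<mu>) \<in> V} | (f :: 'a \<Rightarrow> real) V.
        continuous_on UNIV f \<and> bounded (range f) \<and> open V}"
    by (intro CollectI exI[of _ "\<lambda>_. 0"] exI[of _ UNIV]) auto
  with \<mu> show "\<mu> \<in> \<Union> {{\<mu> \<in> finite_borel_measures. (\<integral>x. f x \<partial>\<mu>) \<in> V} | (f :: 'a \<Rightarrow> real) V.
        continuous_on UNIV f \<and> bounded (range f) \<and> open V}"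
    by blast
qed auto

lemma zero_counting_measure_in_topspace: "zero_counting_measure n p \<in> topspace weak_star_topology"
proof (cases "p = 0")
  case True
  then show ?thesis
    by (auto simp: topspace_weak_star finite_borel_measures_def zero_counting_measure_def
        intro!: finite_measureI)
next
  case False
  have "sets (zero_counting_measure n p) = sets borel"
    using False by (simp add: zero_counting_measure_def)
  moreover from this have "space (zero_counting_measure n p) = UNIV"
    using sets_eq_imp_space_eq by fastforce
  moreover have "emeasure (zero_counting_measure n p) UNIV \<noteq> \<infinity>"
    using False by (simp add: emeasure_zero_counting_measure)
  ultimately show ?thesis
    by (auto simp: topspace_weak_star finite_borel_measures_def intro!: finite_measureI)
qed

lemma circle_measure_in_topspace: "circle_measure \<in> topspace weak_star_topology"
proof -
  have "prob_space (uniform_measure lborel {0..2 * pi})"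
    by (rule prob_space_uniform_measure) auto
  moreover have "cis \<in> borel_measurable borel"
    by (auto intro!: borel_measurable_continuous_onI continuous_intros)
  then have "cis \<in> measurable (uniform_measure lborel {0..2 * pi}) borel"
    by (simp add: measurable_def)
  ultimately have "prob_space circle_measure"
    unfolding circle_measure_def by (rule prob_space.prob_space_distr)
  then show ?thesis
    by (simp add: topspace_weak_star finite_borel_measures_def prob_space.finite_measure)
      (simp add: circle_measure_def)
qed

end

theory Submission
  imports Defs "HOL-Complex_Analysis.Complex_Analysis"
    "HOL-Computational_Algebra.Fundamental_Theorem_Algebra" "HOL-Real_Asymp.Real_Asymp"
begin

text \<open>If \<open>P(|\<xi>| > exp t) = o(1/t)\<close>, then with high probability all coefficients of the polynomial are at most
  \<open>exp (\<epsilon> n)\<close>, while some coefficient with index near \<open>0\<close> and some coefficient with index near \<open>n\<close> are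
  at least \<open>exp (-\<epsilon> n)\<close>. These conditions alone, with no anti-concentration, force equidistribution of the
  roots: reflecting the few roots in \<open>|z| < \<rho>\<close> in the unit circle bounds their number, the same
  bound for the reversed polynomial handles the roots outside, and the Borel-Caratheodory inequality
  for the logarithm of the polynomial with reflected roots shows that all power sums of the inverse
  roots are \<open>o(n)\<close>. These power sums are the Fourier coefficients of the limit.

  If the tail condition fails, then for suitable arbitrarily large \<open>n\<close> and with probability bounded
  below, a coefficient of modulus more than \<open>exp t\<close> occurs, while the first half of the coefficients
  stays below \<open>exp (t/2)\<close>, where \<open>t \<ge> 20 n\<close>. Such a polynomial has a positive fraction of its
  roots in \<open>|z| < 1/2\<close>.\<close>

text \<open>The obstacle is that no prescribed coefficient is controlled: |p(0)| may be tiny or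
  zero, so Jensen's formula at the origin says nothing. The lower bound comes instead from an
  unspecified coefficient of index at most \<epsilon> n, through Cauchy's estimate on a circle of
  fixed radius, at the cost of a factor exp (O(\<epsilon> n)). Reflection then serves twice: it
  clears a disc of zeros, so that a logarithm exists there, and it keeps the modulus on the unit
  circle, so that the upper bound survives. Randomness is kept apart. \<open>flat\<close> is a
  property of a single polynomial, and \<open>flat_imp_in_open\<close> yields one pair (\<epsilon>,
  n0) valid for every polynomial, so sufficiency reduces to bounding the probabilities of three bad
  events. Non-degeneracy enters as a level a > 0 that |\<xi>| reaches with positive probability. A
  second obstacle is measurability: \<open>measure\<close> is 0 on non-measurable sets, so for
  sufficiency the event of an arbitrary weak* open set must be shown measurable. This is why the
  continuity of roots in the coefficients is developed.\<close>

section \<open>Root factorization and the low coefficients\<close>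

lemma poly_prod_mset: "poly (\<Prod>z\<in>#A. f z) x = (\<Prod>z\<in>#A. poly (f z) x)"
  by (induction A) auto

text \<open>This normalization keeps every factor bounded on a fixed circle: z - w for a small root
  w, and 1 - z/w, of modulus at most 1 + |z|/\<rho>, for a root that may be arbitrarily large. All
  the scale goes into K.\<close>

lemma factorization_at_radius:
  fixes p :: "complex poly"
  assumes "p \<noteq> 0" "\<rho> > 0"
  obtains K where "K \<noteq> 0"
    "p = smult K ((\<Prod>z\<in>#{#z \<in># proots p. cmod z < \<rho>#}. [:-z, 1:]) *
                  (\<Prod>z\<in>#{#z \<in># proots p. \<not> cmod z < \<rho>#}. [:1, -(1/z):]))"
proof -
  have aux: "(\<Prod>z\<in>#A. [:-z, 1:]) = smult (\<Prod>z\<in>#A. -z) (\<Prod>z\<in>#A. [:1, -(1/z):])"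
    "(\<Prod>z\<in>#A. -z) \<noteq> 0" if "\<And>z. z \<in># A \<Longrightarrow> z \<noteq> 0" for A :: "complex multiset"
    using that
  proof (induction A)
    case (add w A)
    case 1
    have "[:-w, 1:] = smult (-w) [:1, -(1/w):]"
      using 1[of w] by simp
    with add.IH(1) 1 show ?case
      by (simp only: image_mset_add_mset prod_mset.add_mset mult_smult_left mult_smult_right smult_smult)
        (simp add: mult_ac del: mult_pCons_left mult_pCons_right)
  qed auto
  let ?S = "{#z \<in># proots p. cmod z < \<rho>#}" and ?L = "{#z \<in># proots p. \<not> cmod z < \<rho>#}"
  have nz: "z \<noteq> 0" if "z \<in># ?L" for z
    using that assms(2) by auto
  have "p = smult (lead_coeff p) (\<Prod>z\<in>#proots p. [:-z, 1:])"
    by (simp add: complex_poly_decompose_multiset)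
  also have "proots p = ?S + ?L"
    by simp
  also have "(\<Prod>z\<in>#?S + ?L. [:-z, 1:]) = (\<Prod>z\<in>#?S. [:-z, 1:]) * (\<Prod>z\<in>#?L. [:-z, 1:])"
    by (simp only: image_mset_union prod_mset.union)
  also have "smult (lead_coeff p) \<dots> = smult (lead_coeff p * (\<Prod>z\<in>#?L. -z))
     ((\<Prod>z\<in>#?S. [:-z, 1:]) * (\<Prod>z\<in>#?L. [:1, -(1/z):]))"
    using aux(1)[of ?L] nz by simp
  finally show ?thesis
    using that aux(2)[of ?L] nz assms(1) by (metis (no_types, lifting) leading_coeff_0_iff mult_eq_0_iff)
qed

lemma coeff_eq_higher_deriv:
  fixes p :: "complex poly"
  shows "(deriv ^^ k) (poly p) 0 = fact k * coeff p k"
proof -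
  have d: "deriv (poly q) = poly (pderiv q)" for q :: "complex poly"
    by (rule ext) (simp add: DERIV_imp_deriv poly_DERIV)
  have "(deriv ^^ k) (poly p) = poly ((pderiv ^^ k) p)"
    by (induction k arbitrary: p) (simp_all add: d funpow_Suc_right del: funpow.simps)
  then show ?thesis
    by (simp add: poly_0_coeff_0 coeff_higher_pderiv pochhammer_fact)
qed

lemma norm_coeff_le:
  fixes p :: "complex poly"
  assumes "r > 0" "\<And>z. cmod z = r \<Longrightarrow> cmod (poly p z) \<le> B"
  shows "cmod (coeff p k) * r ^ k \<le> B"
proof -
  have "cmod ((deriv ^^ k) (poly p) 0) \<le> fact k * B / r ^ k"
    using assms by (intro Cauchy_inequality) (auto intro!: holomorphic_intros continuous_intros)
  then have "fact k * cmod (coeff p k) \<le> fact k * (B / r ^ k)"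
    by (simp add: coeff_eq_higher_deriv norm_mult)
  then show ?thesis
    using assms(1) by (simp add: field_simps)
qed

text \<open>The weight \<open>x ^ j\<close> makes the loss per linear factor a constant, independently of the cutoff \<open>k\<close>.\<close>

lemma low_coeffs_mult_linear:
  fixes p :: "complex poly"
  assumes "x \<ge> 0"
  shows "(1 - x * cmod a) * (\<Sum>j\<le>k. cmod (coeff p j) * x ^ j)
           \<le> (\<Sum>j\<le>k. cmod (coeff (p * [:1, -a:]) j) * x ^ j)"
proof -
  let ?L = "\<Sum>j\<le>k. cmod (coeff p j) * x ^ j"
  let ?c = "\<lambda>j. case j of 0 \<Rightarrow> 0 | Suc i \<Rightarrow> coeff p i"
  have c: "coeff (p * [:1, -a:]) j = coeff p j - a * ?c j" for j
    by (simp add: coeff_pCons split: nat.splits)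
  have "(\<Sum>j\<le>k. cmod (?c j) * x ^ j) = x * (\<Sum>j<k. cmod (coeff p j) * x ^ j)"
    by (cases k) (simp_all add: sum.atMost_Suc_shift sum_distrib_left algebra_simps
        lessThan_Suc_atMost del: sum.atMost_Suc)
  also have "\<dots> \<le> x * ?L"
    using assms by (intro mult_left_mono sum_mono2) auto
  finally have "cmod a * (\<Sum>j\<le>k. cmod (?c j) * x ^ j) \<le> cmod a * (x * ?L)"
    by (rule mult_left_mono) auto
  moreover have "?L - cmod a * (\<Sum>j\<le>k. cmod (?c j) * x ^ j) \<le>
      (\<Sum>j\<le>k. cmod (coeff (p * [:1, -a:]) j) * x ^ j)"
    unfolding sum_distrib_left sum_subtractf[symmetric] c
  proof (rule sum_mono)
    fix j
    have "cmod (coeff p j) - cmod (a * ?c j) \<le> cmod (coeff p j - a * ?c j)"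
      by (rule norm_triangle_ineq2)
    then have "(cmod (coeff p j) - cmod (a * ?c j)) * x ^ j \<le> cmod (coeff p j - a * ?c j) * x ^ j"
      using assms by (intro mult_right_mono) auto
    then show "cmod (coeff p j) * x ^ j - cmod a * (cmod (?c j) * x ^ j)
        \<le> cmod (coeff p j - a * ?c j) * x ^ j"
      by (simp add: norm_mult algebra_simps)
  qed
  ultimately show ?thesis
    by (simp add: algebra_simps)
qed

text \<open>The a are meant to be reciprocals of roots outside |z| < 1/2. As |a| <= 2, the weight
  1/4 gives 1 - |a|/4 >= 1/2, hence one factor 1/2 per root.\<close>

lemma low_coeffs_mult_linears:
  fixes p :: "complex poly"
  assumes "\<And>a. a \<in># A \<Longrightarrow> cmod a \<le> 2"
  shows "(1/2) ^ size A * (\<Sum>j\<le>k. cmod (coeff p j) * (1/4) ^ j)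
           \<le> (\<Sum>j\<le>k. cmod (coeff (p * (\<Prod>a\<in>#A. [:1, -a:])) j) * (1/4) ^ j)"
  using assms
proof (induction A)
  case (add a A)
  let ?L = "\<lambda>q :: complex poly. \<Sum>j\<le>k. cmod (coeff q j) * (1/4) ^ j"
  have "1/2 * ?L (p * (\<Prod>a\<in>#A. [:1, -a:])) \<le>
      (1 - 1/4 * cmod a) * ?L (p * (\<Prod>a\<in>#A. [:1, -a:]))"
    using add.prems[of a] by (intro mult_right_mono sum_nonneg) auto
  also have "\<dots> \<le> ?L (p * (\<Prod>a\<in>#A. [:1, -a:]) * [:1, -a:])"
    by (rule low_coeffs_mult_linear) simp
  finally have "1/2 * ?L (p * (\<Prod>a\<in>#A. [:1, -a:])) \<le> ?L (p * (\<Prod>a\<in>#add_mset a A. [:1, -a:]))"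
    by (simp only: image_mset_add_mset prod_mset.add_mset mult_ac)
  moreover have "(1/2) ^ size A * ?L p \<le> ?L (p * (\<Prod>a\<in>#A. [:1, -a:]))"
    using add by simp
  ultimately show ?case
    by (simp add: mult.assoc del: mult_pCons_left mult_pCons_right)
qed simp

lemma degree_prod_mset_linear:
  "degree (\<Prod>z\<in>#A. [:-z, 1:] :: complex poly) = size A"
  "lead_coeff (\<Prod>z\<in>#A. [:-z, 1:] :: complex poly) = 1"
proof -
  show "lead_coeff (\<Prod>z\<in>#A. [:-z, 1:] :: complex poly) = 1"
    by (induction A) (auto simp: lead_coeff_mult simp del: mult_pCons_left mult_pCons_right)
  show "degree (\<Prod>z\<in>#A. [:-z, 1:] :: complex poly) = size A"
  proof (induction A)
    case (add z A)
    have "(\<Prod>z\<in>#A. [:-z, 1:] :: complex poly) \<noteq> 0"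
      by (auto simp: prod_mset_zero_iff)
    with add show ?case
      by (simp add: degree_mult_eq del: mult_pCons_left mult_pCons_right)
  qed simp
qed

lemma prod_mset_le_power:
  fixes f :: "'a \<Rightarrow> real"
  assumes "\<And>x. x \<in># A \<Longrightarrow> 0 \<le> f x" "\<And>x. x \<in># A \<Longrightarrow> f x \<le> c"
  shows "(\<Prod>x\<in>#A. f x) \<le> c ^ size A" "0 \<le> (\<Prod>x\<in>#A. f x)"
proof -
  have "(\<Prod>x\<in>#A. f x) \<le> c ^ size A \<and> 0 \<le> (\<Prod>x\<in>#A. f x)"
    using assms
  proof (induction A)
    case (add a A)
    then have "(\<Prod>x\<in>#A. f x) \<le> c ^ size A \<and> 0 \<le> (\<Prod>x\<in>#A. f x)" "0 \<le> f a" "f a \<le> c"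
      by auto
    then show ?case
      by (auto intro!: mult_mono)
  qed simp
  then show "(\<Prod>x\<in>#A. f x) \<le> c ^ size A" "0 \<le> (\<Prod>x\<in>#A. f x)" by auto
qed

lemma norm_prod_mset: "cmod (\<Prod>x\<in>#A. f x) = (\<Prod>x\<in>#A. cmod (f x))"
  by (induction A) (auto simp: norm_mult)

text \<open>Both sides are compared with the scale |K| of the factorization. Each linear factor has
  modulus at most 3 on |z| = 1, so every coefficient is at most 3^n |K|. The monic product over the
  k small roots has its leading 1 at index k, just inside the cutoff, and each remaining factor
  loses at most 1/2, so the coefficients up to k sum to at least |K| / 8^n. Hence 24 = 3 * 8. Read
  backwards: if a coefficient is huge compared with the low ones, then k is large.\<close>

lemma coeff_le_low_coeffs:
  fixes p :: "complex poly"
  assumes "p \<noteq> 0" "degree p \<le> n"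
  defines "k \<equiv> size {#z \<in># proots p. cmod z < 1/2#}"
  shows "cmod (coeff p j) \<le> 24 ^ n * (\<Sum>i\<le>k. cmod (coeff p i))"
proof -
  let ?S = "{#z \<in># proots p. cmod z < 1/2#}" and ?L = "{#z \<in># proots p. \<not> cmod z < 1/2#}"
  let ?s = "\<Prod>z\<in>#?S. [:-z, 1:]" and ?l = "\<Prod>z\<in>#?L. [:1, -(1/z):]"
  obtain K where K: "K \<noteq> 0" and p: "p = smult K (?s * ?l)"
    using assms(1) by (rule factorization_at_radius[of p "1/2"]) auto
  have "size (?S + ?L) = degree p"
    using size_proots_complex[of p] by simp
  then have size: "k + size ?L \<le> n"
    using assms(2) by (simp only: size_union k_def)
  have up: "cmod (coeff p j) * 1 ^ j \<le> cmod K * 3 ^ n"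
  proof (rule norm_coeff_le)
    fix z :: complex assume z: "cmod z = 1"
    have "cmod (poly ?s z) \<le> 3 ^ k"
      unfolding poly_prod_mset norm_prod_mset k_def
    proof (rule prod_mset_le_power)
      fix w assume "w \<in># ?S"
      then show "cmod (poly [:-w, 1:] z) \<le> 3"
        using z norm_triangle_ineq4[of z w] by auto
    qed auto
    moreover have "cmod (poly ?l z) \<le> 3 ^ size ?L"
      unfolding poly_prod_mset norm_prod_mset
    proof (rule prod_mset_le_power)
      fix w assume "w \<in># ?L"
      then have "1 / cmod w \<le> 2"
        using divide_left_mono[of "1/2" "cmod w" 1] by (cases "w = 0") auto
      then show "cmod (poly [:1, -(1/w):] z) \<le> 3"
        using z norm_triangle_ineq4[of 1 "z / w"] by (auto simp: norm_divide)
    qed auto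
    ultimately have "cmod (poly p z) \<le> cmod K * (3 ^ k * 3 ^ size ?L)"
      by (subst p) (auto simp: norm_mult intro!: mult_left_mono mult_mono)
    also have "\<dots> \<le> cmod K * 3 ^ n"
      using size by (auto simp flip: power_add intro!: mult_left_mono power_increasing)
    finally show "cmod (poly p z) \<le> cmod K * 3 ^ n" .
  qed simp
  have "(1/4) ^ k \<le> (\<Sum>i\<le>k. cmod (coeff ?s i) * (1/4) ^ i)"
    using degree_prod_mset_linear[of ?S] member_le_sum[of k "{..k}" "\<lambda>i. cmod (coeff ?s i) * (1/4) ^ i"]
    by (simp add: k_def)
  then have "(1/2) ^ size ?L * (1/4) ^ k \<le> (1/2) ^ size ?L * (\<Sum>i\<le>k. cmod (coeff ?s i) * (1/4) ^ i)"
    by (rule mult_left_mono) auto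
  also have "\<dots> \<le> (\<Sum>i\<le>k. cmod (coeff (?s * ?l) i) * (1/4) ^ i)"
  proof -
    have "cmod (1 / z) \<le> 2" if "z \<in># ?L" for z
      using that divide_left_mono[of "1/2" "cmod z" 1] by (cases "z = 0") (auto simp: norm_divide)
    then have "cmod a \<le> 2" if "a \<in># image_mset (\<lambda>z. 1/z) ?L" for a
      using that by auto
    then show ?thesis
      using low_coeffs_mult_linears[of "image_mset (\<lambda>z. 1/z) ?L" ?s k]
      by (simp only: image_mset.compositionality o_def size_image_mset)
  qed
  also have "\<dots> \<le> (\<Sum>i\<le>k. cmod (coeff (?s * ?l) i))"
    by (intro sum_mono mult_left_le) (auto simp: power_le_one)
  finally have "cmod K * ((1/2) ^ size ?L * (1/4) ^ k) \<le> cmod K * (\<Sum>i\<le>k. cmod (coeff (?s * ?l) i))"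
    by (rule mult_left_mono) auto
  also have "\<dots> = (\<Sum>i\<le>k. cmod (coeff p i))"
    by (subst (2) p) (simp add: norm_mult sum_distrib_left)
  finally have low: "cmod K * ((1/2) ^ size ?L * (1/4) ^ k) \<le> (\<Sum>i\<le>k. cmod (coeff p i))" .
  have "(1/8::real) ^ n \<le> (1/8) ^ (size ?L + k)"
    using size by (intro power_decreasing) auto
  also have "\<dots> \<le> (1/2) ^ size ?L * (1/4) ^ k"
    unfolding power_add by (intro mult_mono power_mono) auto
  finally have "cmod K * (1/8) ^ n \<le> cmod K * ((1/2) ^ size ?L * (1/4) ^ k)"
    by (rule mult_left_mono) auto
  with low have "cmod K * (1/8) ^ n \<le> (\<Sum>i\<le>k. cmod (coeff p i))"
    by simp
  then have "cmod K * (1/8) ^ n * 24 ^ n \<le> (\<Sum>i\<le>k. cmod (coeff p i)) * 24 ^ n"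
    by (rule mult_right_mono) auto
  moreover have "cmod K * (1/8) ^ n * 24 ^ n = cmod K * 3 ^ n"
    unfolding mult.assoc power_mult_distrib[symmetric] by simp
  ultimately have "cmod K * 3 ^ n \<le> (\<Sum>i\<le>k. cmod (coeff p i)) * 24 ^ n"
    by (simp only:)
  with up show ?thesis
    by (simp add: mult.commute)
qed

section \<open>Reflection of roots in the unit circle\<close>

text \<open>Compares denominator and numerator of the Blaschke factor (z - w) / (1 - cnj w z): the
  difference vanishes on |z| = 1 and is positive when both points lie in the open disc.\<close>

lemma blaschke_identity:
  "(cmod (1 - cnj w * z))\<^sup>2 - (cmod (z - w))\<^sup>2 = (1 - (cmod z)\<^sup>2) * (1 - (cmod w)\<^sup>2)"
proof -
  have "complex_of_real ((cmod (1 - cnj w * z))\<^sup>2 - (cmod (z - w))\<^sup>2) =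
        complex_of_real ((1 - (cmod z)\<^sup>2) * (1 - (cmod w)\<^sup>2))"
    unfolding of_real_diff of_real_mult complex_norm_square of_real_1
    by (simp add: algebra_simps)
  then show ?thesis
    by (simp only: of_real_eq_iff)
qed

text \<open>The radicand is 1 - (3/4)(1 - \<rho>^2)/4. Here 3/4 bounds 1 - |z|^2 from below on |z|
  <= 1/2, 1 - \<rho>^2 bounds 1 - |w|^2 from below, and 4 bounds |1 - cnj w z|^2 from above;
  \<open>blaschke_identity\<close> turns these into a bound on the squared Blaschke factor.\<close>

definition blaschke_gain :: "real \<Rightarrow> real" where
  "blaschke_gain \<rho> = sqrt ((13 + 3 * \<rho>\<^sup>2) / 16)"

lemma blaschke_gain:
  assumes "0 < \<rho>" "\<rho> < 1"
  shows "0 < blaschke_gain \<rho>" "blaschke_gain \<rho> < 1"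
proof -
  have "0 < \<rho>\<^sup>2" "\<rho>\<^sup>2 < 1"
    using assms by (auto simp: power_less_one_iff)
  then show "0 < blaschke_gain \<rho>" "blaschke_gain \<rho> < 1"
    by (simp_all add: blaschke_gain_def add_pos_pos)
qed

lemma blaschke_factor_le:
  assumes "cmod z \<le> 1/2" "cmod w < \<rho>" "\<rho> < 1"
  shows "cmod (z - w) \<le> blaschke_gain \<rho> * cmod (1 - cnj w * z)"
proof -
  have \<rho>: "0 < \<rho>"
    using assms(2) norm_ge_zero[of w] by linarith
  have z2: "(cmod z)\<^sup>2 \<le> 1/4"
    using power_mono[OF assms(1), of 2] by (simp add: power_divide)
  have w2: "(cmod w)\<^sup>2 \<le> \<rho>\<^sup>2"
    using assms(2) by (intro power_mono) auto
  have \<rho>2: "\<rho>\<^sup>2 < 1"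
    using \<rho> assms(3) by (auto simp: power_less_one_iff)
  have "cmod (1 - cnj w * z) \<le> 1 + cmod w * cmod z"
    using norm_triangle_ineq4[of 1 "cnj w * z"] by (simp add: norm_mult)
  also have "\<dots> \<le> 2"
    using mult_mono[of "cmod w" 1 "cmod z" 1] assms by auto
  finally have "(cmod (1 - cnj w * z))\<^sup>2 \<le> 4"
    using power_mono[of "cmod (1 - cnj w * z)" 2 2] by simp
  then have "(3 * (1 - \<rho>\<^sup>2) / 16) * (cmod (1 - cnj w * z))\<^sup>2 \<le> (3 * (1 - \<rho>\<^sup>2) / 16) * 4"
    using \<rho>2 by (intro mult_left_mono) auto
  also have "\<dots> = (3/4) * (1 - \<rho>\<^sup>2)"
    by simp
  also have "\<dots> \<le> (1 - (cmod z)\<^sup>2) * (1 - (cmod w)\<^sup>2)"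
    using z2 w2 \<rho>2 by (intro mult_mono) auto
  finally have "(cmod (z - w))\<^sup>2 \<le> ((13 + 3 * \<rho>\<^sup>2) / 16) * (cmod (1 - cnj w * z))\<^sup>2"
    using blaschke_identity[of w z] by (simp add: field_simps)
  also have "\<dots> = (blaschke_gain \<rho> * cmod (1 - cnj w * z))\<^sup>2"
  proof -
    have "0 \<le> (13 + 3 * \<rho>\<^sup>2) / 16"
      by (intro divide_nonneg_nonneg add_nonneg_nonneg) auto
    then show ?thesis
      by (simp only: blaschke_gain_def power_mult_distrib real_sqrt_pow2)
  qed
  finally show ?thesis
    by (rule power2_le_imp_le) (use blaschke_gain[OF \<rho> assms(3)] in auto)
qed

lemma blaschke_factor_unit:
  assumes "cmod z = 1"
  shows "cmod (1 - cnj w * z) = cmod (z - w)"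
proof -
  have "(cmod (1 - cnj w * z))\<^sup>2 = (cmod (z - w))\<^sup>2"
    using blaschke_identity[of w z] assms by simp
  then show ?thesis
    by (auto intro: power2_eq_imp_eq)
qed

text \<open>z - a and 1 - cnj a z have equal modulus on |z| = 1, so h inherits the bound B there
  and, by the maximum modulus principle, in the whole disc. On |z| <= 1/2 each exchanged factor
  gains a constant below 1, so many small roots make p exponentially smaller than B.\<close>

lemma reflect_small_roots:
  fixes Q :: "complex poly"
  assumes A: "\<And>a. a \<in># A \<Longrightarrow> cmod a < \<rho>" and \<rho>: "0 < \<rho>" "\<rho> < 1"
  assumes p: "p = (\<Prod>a\<in>#A. [:-a, 1:]) * Q"
    and B: "\<And>z. cmod z = 1 \<Longrightarrow> cmod (poly p z) \<le> B"
  defines "h \<equiv> (\<Prod>a\<in>#A. [:1, -cnj a:]) * Q"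
  shows "cmod z \<le> 1 \<Longrightarrow> cmod (poly h z) \<le> B"
    and "cmod z \<le> 1/2 \<Longrightarrow> cmod (poly p z) \<le> blaschke_gain \<rho> ^ size A * cmod (poly h z)"
proof -
  show "cmod (poly h z) \<le> B" if "cmod z \<le> 1"
  proof (rule maximum_modulus_frontier[of "poly h" "cball 0 1"])
    fix z :: complex assume "z \<in> frontier (cball 0 1)"
    then have z: "cmod z = 1"
      by (simp add: dist_norm)
    have "cmod (poly h z) = cmod (poly p z)"
      unfolding h_def p using z
      by (simp add: norm_mult poly_prod_mset norm_prod_mset mult.commute[of z] blaschke_factor_unit)
    then show "cmod (poly h z) \<le> B"
      using B z by simp
  qed (use that in \<open>auto intro!: holomorphic_intros continuous_intros\<close>)
  show "cmod (poly p z) \<le> blaschke_gain \<rho> ^ size A * cmod (poly h z)" if "cmod z \<le> 1/2"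
  proof -
    have "(\<Prod>a\<in>#A. cmod (z - a)) \<le> blaschke_gain \<rho> ^ size A * (\<Prod>a\<in>#A. cmod (1 - cnj a * z))"
      using A
    proof (induction A)
      case (add a A)
      have "cmod (z - a) * (\<Prod>a\<in>#A. cmod (z - a)) \<le> (blaschke_gain \<rho> * cmod (1 - cnj a * z)) *
          (blaschke_gain \<rho> ^ size A * (\<Prod>a\<in>#A. cmod (1 - cnj a * z)))"
        using add \<rho> that blaschke_gain[OF \<rho>]
        by (intro mult_mono blaschke_factor_le)
          (auto intro!: mult_nonneg_nonneg simp flip: norm_prod_mset)
      then show ?case
        by (simp add: mult_ac)
    qed auto
    then have "(\<Prod>a\<in>#A. cmod (z - a)) * cmod (poly Q z) \<le>
        blaschke_gain \<rho> ^ size A * (\<Prod>a\<in>#A. cmod (1 - cnj a * z)) * cmod (poly Q z)"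
      by (rule mult_right_mono) auto
    then show ?thesis
      by (simp add: p h_def norm_mult poly_prod_mset norm_prod_mset mult_ac)
  qed
qed

lemma norm_poly_le_card_coeffs:
  fixes p :: "complex poly"
  assumes "degree p \<le> n" "\<And>j. cmod (coeff p j) \<le> B" "cmod z = 1"
  shows "cmod (poly p z) \<le> (real n + 1) * B"
proof -
  have "cmod (poly p z) \<le> (\<Sum>j\<le>degree p. cmod (coeff p j * z ^ j))"
    unfolding poly_altdef by (rule norm_sum)
  also have "\<dots> \<le> (\<Sum>j\<le>degree p. B)"
    using assms by (intro sum_mono) (simp add: norm_mult norm_power)
  also have "\<dots> = (real (degree p) + 1) * B"
    by simp
  also have "\<dots> \<le> (real n + 1) * B"
    using assms order_trans[OF norm_ge_zero assms(2)[of 0]] by (intro mult_right_mono) auto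
  finally show ?thesis .
qed

section \<open>Few roots inside the unit disc\<close>

text \<open>Only the low end of the coefficients is bounded below, so that the notion applies to a
  polynomial and, separately, to its reversal.\<close>

definition low_flat :: "real \<Rightarrow> nat \<Rightarrow> complex poly \<Rightarrow> bool" where
  "low_flat \<epsilon> n p \<longleftrightarrow> degree p \<le> n \<and> (\<forall>j. cmod (coeff p j) \<le> exp (\<epsilon> * n)) \<and>
     (\<exists>k. real k \<le> \<epsilon> * n \<and> exp (-(\<epsilon> * n)) \<le> cmod (coeff p k))"

lemma low_flat_nonzero: "low_flat \<epsilon> n p \<Longrightarrow> p \<noteq> 0"
  by (auto simp: low_flat_def)

text \<open>The coefficient of index k is at most 2^k times the maximum of |p| on |z| = 1/2, which
  is at most the bound on the unit circle times one gain per small root. In logarithms \<epsilon> n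
  occurs three times: in the lower bound for the coefficient, in the upper bound on the circle, and
  in k ln 2 <= k.\<close>

lemma low_flat_size_small_roots:
  assumes "low_flat \<epsilon> n p" "0 < \<rho>" "\<rho> < 1"
  shows "real (size {#z \<in># proots p. cmod z < \<rho>#}) * (- ln (blaschke_gain \<rho>))
           \<le> 3 * (\<epsilon> * n) + ln (real n + 1)"
proof -
  let ?S = "{#z \<in># proots p. cmod z < \<rho>#}" and ?L = "{#z \<in># proots p. \<not> cmod z < \<rho>#}"
  let ?B = "(real n + 1) * exp (\<epsilon> * n)"
  obtain k where k: "real k \<le> \<epsilon> * n" "exp (-(\<epsilon> * n)) \<le> cmod (coeff p k)"
    using assms(1) by (auto simp: low_flat_def)
  obtain K where "p = smult K ((\<Prod>z\<in>#?S. [:-z, 1:]) * (\<Prod>z\<in>#?L. [:1, -(1/z):]))"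
    using low_flat_nonzero[OF assms(1)] assms(2) by (rule factorization_at_radius)
  then have p: "p = (\<Prod>z\<in>#?S. [:-z, 1:]) * smult K (\<Prod>z\<in>#?L. [:1, -(1/z):])"
    by simp
  have B: "cmod (poly p z) \<le> ?B" if "cmod z = 1" for z
    using assms(1) that by (intro norm_poly_le_card_coeffs) (auto simp: low_flat_def)
  have "cmod (coeff p k) * (1/2) ^ k \<le> blaschke_gain \<rho> ^ size ?S * ?B"
  proof (rule norm_coeff_le)
    fix z :: complex assume "cmod z = 1/2"
    let ?h = "(\<Prod>a\<in>#?S. [:1, -cnj a:]) * smult K (\<Prod>z\<in>#?L. [:1, -(1/z):])"
    have "cmod (poly p z) \<le> blaschke_gain \<rho> ^ size ?S * cmod (poly ?h z)"
      by (rule reflect_small_roots(2)[OF _ assms(2,3) p B]) (use \<open>cmod z = 1/2\<close> in auto)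
    also have "\<dots> \<le> blaschke_gain \<rho> ^ size ?S * ?B"
    proof (rule mult_left_mono)
      show "cmod (poly ?h z) \<le> ?B"
        by (rule reflect_small_roots(1)[OF _ assms(2,3) p B]) (use \<open>cmod z = 1/2\<close> in auto)
    qed (use blaschke_gain[OF assms(2,3)] in auto)
    finally show "cmod (poly p z) \<le> blaschke_gain \<rho> ^ size ?S * ?B" .
  qed simp
  then have "exp (-(\<epsilon> * n)) * (1/2) ^ k \<le> blaschke_gain \<rho> ^ size ?S * ?B"
    by (rule order_trans[OF mult_right_mono[OF k(2)], rotated]) simp
  then have "ln (exp (-(\<epsilon> * n)) * (1/2) ^ k) \<le> ln (blaschke_gain \<rho> ^ size ?S * ?B)"
    using blaschke_gain[OF assms(2,3)] by (intro ln_mono) auto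
  moreover have "ln (exp (-(\<epsilon> * n)) * (1/2) ^ k) = -(\<epsilon> * n) - real k * ln 2"
    by (simp add: ln_mult ln_realpow ln_div)
  moreover have "real k * ln 2 \<le> real k * 1"
    using ln_le_minus_one[of 2] by (intro mult_left_mono) auto
  moreover have "ln (blaschke_gain \<rho> ^ size ?S * ?B) =
      real (size ?S) * ln (blaschke_gain \<rho>) + ln (real n + 1) + \<epsilon> * n"
    using blaschke_gain[OF assms(2,3)] by (simp add: ln_mult ln_realpow)
  ultimately show ?thesis
    using k(1) by simp
qed

section \<open>Borel-Caratheodory and the power sums of inverse roots\<close>

text \<open>The Moebius map w / (2M - w) sends the half-plane Re w < M into the unit disc and fixes
  0. Schwarz's lemma, after rescaling the disc, gives |f z| <= (|z|/R)(2M + |f z|), which is solved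
  for |f z|.\<close>

lemma Borel_Caratheodory:
  assumes holf: "f holomorphic_on ball 0 R" and f0: "f 0 = 0"
    and Re: "\<And>z. cmod z < R \<Longrightarrow> Re (f z) < M" and z: "cmod z < R"
  shows "cmod (f z) \<le> 2 * M * cmod z / (R - cmod z)"
proof -
  have R: "R > 0"
    using z norm_ge_zero[of z] by linarith
  have M: "M > 0"
    using Re[of 0] R f0 by simp
  define g where "g = (\<lambda>\<zeta>. f (of_real R * \<zeta>) / (of_real (2 * M) - f (of_real R * \<zeta>)))"
  have sub: "cmod (of_real R * \<zeta>) < R" if "cmod \<zeta> < 1" for \<zeta>
    using that R by (simp add: norm_mult)
  have nz: "of_real (2 * M) - f (of_real R * \<zeta>) \<noteq> 0" if "cmod \<zeta> < 1" for \<zeta>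
  proof
    assume "of_real (2 * M) - f (of_real R * \<zeta>) = 0"
    then have "Re (f (of_real R * \<zeta>)) = 2 * M"
      by (metis Re_complex_of_real eq_iff_diff_eq_0)
    then show False
      using Re[OF sub[OF that]] M by simp
  qed
  have "(\<lambda>\<zeta>. f (of_real R * \<zeta>)) holomorphic_on ball 0 1"
  proof -
    have "(\<lambda>\<zeta>. complex_of_real R * \<zeta>) holomorphic_on ball 0 1"
      by (intro holomorphic_intros)
    moreover have "(\<lambda>\<zeta>. complex_of_real R * \<zeta>) ` ball 0 1 \<subseteq> ball 0 R"
      using sub by auto
    ultimately show ?thesis
      using holomorphic_on_compose_gen[OF _ holf] by (simp only: o_def)
  qed
  then have holg: "g holomorphic_on ball 0 1"
    unfolding g_def using nz by (intro holomorphic_intros) auto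
  have g1: "cmod (g \<zeta>) < 1" if "cmod \<zeta> < 1" for \<zeta>
  proof -
    let ?w = "f (of_real R * \<zeta>)"
    have "(cmod (of_real (2 * M) - ?w))\<^sup>2 - (cmod ?w)\<^sup>2 = 4 * M * (M - Re ?w)"
      unfolding cmod_power2 by (simp add: power2_eq_square algebra_simps)
    also have "\<dots> > 0"
      using M Re[OF sub[OF that]] by simp
    finally have "cmod ?w < cmod (of_real (2 * M) - ?w)"
      by (intro power2_less_imp_less[of "cmod ?w"]) auto
    moreover have "cmod (of_real (2 * M) - ?w) > 0"
      using nz[OF that] by simp
    ultimately show ?thesis
      by (simp only: g_def norm_divide divide_less_eq_1_pos)
  qed
  define \<zeta> where "\<zeta> = z / of_real R"
  have \<zeta>: "cmod \<zeta> < 1" "of_real R * \<zeta> = z" "cmod \<zeta> = cmod z / R"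
    using z R by (simp_all add: \<zeta>_def norm_divide)
  have "cmod (g \<zeta>) \<le> cmod \<zeta>"
    using holg g1 \<zeta>(1) by (intro Schwarz_Lemma(1)) (auto simp: g_def f0)
  then have "cmod (f z) \<le> cmod \<zeta> * cmod (of_real (2 * M) - f z)"
    using nz[OF \<zeta>(1)] \<zeta>(2) by (simp add: g_def norm_divide divide_le_eq)
  also have "\<dots> \<le> cmod \<zeta> * (2 * M + cmod (f z))"
    using norm_triangle_ineq4[of "of_real (2 * M)" "f z"] M
    by (intro mult_left_mono) auto
  finally show ?thesis
    using R z by (simp add: \<zeta>(3) field_simps)
qed

lemma has_field_derivative_sum_mset:
  assumes "\<And>w. w \<in># W \<Longrightarrow> (f w has_field_derivative f' w) F"
  shows "((\<lambda>z. \<Sum>w\<in>#W. f w z) has_field_derivative (\<Sum>w\<in>#W. f' w)) F"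
  using assms by (induction W) (auto intro!: derivative_eq_intros)

text \<open>For |w| <= 2 and |z| < 1/2 the number 1 - w z has positive real part, so the principal
  logarithm is holomorphic. The function v = w / (1 - w z) satisfies v' = v^2, so all derivatives
  stay multiples of powers of v.\<close>

lemma higher_deriv_sum_mset_Ln:
  assumes "\<And>w. w \<in># W \<Longrightarrow> cmod w \<le> 2"
  shows "(\<lambda>z. \<Sum>w\<in>#W. Ln (1 - w * z)) holomorphic_on ball 0 (1/2)"
    and "(deriv ^^ Suc k) (\<lambda>z. \<Sum>w\<in>#W. Ln (1 - w * z)) 0 = - (fact k * (\<Sum>w\<in>#W. w ^ Suc k))"
proof -
  have pos: "Re (1 - w * z) > 0" if "w \<in># W" "z \<in> ball 0 (1/2)" for w z
  proof -
    have "Re (w * z) \<le> cmod w * cmod z"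
      using complex_Re_le_cmod[of "w * z"] by (simp add: norm_mult)
    also have "\<dots> \<le> 2 * cmod z"
      using assms[OF that(1)] by (intro mult_right_mono) auto
    finally show ?thesis
      using that(2) by (simp add: dist_norm)
  qed
  then have nonpos: "1 - w * z \<notin> \<real>\<^sub>\<le>\<^sub>0" "1 - w * z \<noteq> 0"
    if "w \<in># W" "z \<in> ball 0 (1/2)" for w z
    using that by (fastforce simp: complex_nonpos_Reals_iff)+
  let ?v = "\<lambda>w z. w * inverse (1 - w * z)"
  have v: "(?v w has_field_derivative (?v w z)\<^sup>2) (at z)"
    if "w \<in># W" "z \<in> ball 0 (1/2)" for w z
  proof -
    have "((\<lambda>z. 1 - w * z) has_field_derivative - w) (at z)"
      by (auto intro!: derivative_eq_intros)
    from DERIV_inverse_fun[OF this nonpos(2)[OF that], THEN DERIV_cmult[where c = w]]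
    show ?thesis
      by (simp add: power2_eq_square mult_ac)
  qed
  have d: "((\<lambda>z. \<Sum>w\<in>#W. Ln (1 - w * z)) has_field_derivative (\<Sum>w\<in>#W. - ?v w z)) (at z)"
    if "z \<in> ball 0 (1/2)" for z
  proof (rule has_field_derivative_sum_mset)
    fix w assume w: "w \<in># W"
    have "((\<lambda>z. 1 - w * z) has_field_derivative - w) (at z)"
      by (auto intro!: derivative_eq_intros)
    from DERIV_chain2[where f = Ln and g = "\<lambda>z. 1 - w * z", OF has_field_derivative_Ln[OF nonpos(1)[OF w that]] this]
    show "((\<lambda>z. Ln (1 - w * z)) has_field_derivative - ?v w z) (at z)"
      by (simp only: mult.commute[of _ "- w"] mult_minus_left)
  qed
  show "(\<lambda>z. \<Sum>w\<in>#W. Ln (1 - w * z)) holomorphic_on ball 0 (1/2)"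
    using d unfolding holomorphic_on_open[OF open_ball] by blast
  have "(deriv ^^ Suc k) (\<lambda>z. \<Sum>w\<in>#W. Ln (1 - w * z)) z = (\<Sum>w\<in>#W. - (fact k * ?v w z ^ Suc k))"
    if "z \<in> ball 0 (1/2)" for z
    using that
  proof (induction k arbitrary: z)
    case 0
    then show ?case
      using DERIV_imp_deriv[OF d[OF 0]] by simp
  next
    case (Suc k)
    have "((deriv ^^ Suc k) (\<lambda>z. \<Sum>w\<in>#W. Ln (1 - w * z)) has_field_derivative
        (\<Sum>w\<in>#W. - (fact (Suc k) * ?v w z ^ Suc (Suc k)))) (at z)"
    proof (rule has_field_derivative_transform_within_open)
      show "((\<lambda>z. \<Sum>w\<in>#W. - (fact k * ?v w z ^ Suc k)) has_field_derivative
        (\<Sum>w\<in>#W. - (fact (Suc k) * ?v w z ^ Suc (Suc k)))) (at z)"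
      proof (rule has_field_derivative_sum_mset)
        fix w assume w: "w \<in># W"
        have "((\<lambda>z. - (fact k * ?v w z ^ Suc k)) has_field_derivative
            - (fact k * (of_nat (Suc k) * ((?v w z)\<^sup>2 * ?v w z ^ (Suc k - Suc 0))))) (at z)"
          by (intro DERIV_minus DERIV_cmult DERIV_power v w Suc.prems)
        moreover have "fact k * (of_nat (Suc k) * (V\<^sup>2 * V ^ (Suc k - Suc 0))) =
            fact (Suc k) * V ^ Suc (Suc k)" for V :: complex
          by (simp add: power2_eq_square mult_ac)
        ultimately show "((\<lambda>z. - (fact k * ?v w z ^ Suc k)) has_field_derivative
            - (fact (Suc k) * ?v w z ^ Suc (Suc k))) (at z)"
          by (simp only:)
      qed
      show "(\<Sum>w\<in>#W. - (fact k * ?v w x ^ Suc k)) = (deriv ^^ Suc k) (\<lambda>z. \<Sum>w\<in>#W. Ln (1 - w * z)) x"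
        if "x \<in> ball 0 (1/2)" for x
        using Suc.IH[OF that] by (rule sym)
    qed (use Suc.prems in auto)
    then show ?case
      using DERIV_imp_deriv by (simp only: funpow.simps o_apply)
  qed
  from this[of 0] have "(deriv ^^ Suc k) (\<lambda>z. \<Sum>w\<in>#W. Ln (1 - w * z)) 0 =
      (\<Sum>w\<in>#W. - (fact k * w ^ Suc k))"
    by (simp del: power_Suc funpow.simps)
  also have "\<dots> = - (fact k * (\<Sum>w\<in>#W. w ^ Suc k))"
    by (induction W) (simp_all add: algebra_simps)
  finally show "(deriv ^^ Suc k) (\<lambda>z. \<Sum>w\<in>#W. Ln (1 - w * z)) 0 = - (fact k * (\<Sum>w\<in>#W. w ^ Suc k))" .
qed

text \<open>The logarithm is taken factor by factor because the product itself may cross the branch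
  cut of \<open>Ln\<close>.\<close>

lemma exp_sum_mset_Ln:
  assumes "\<And>w. w \<in># W \<Longrightarrow> w * z \<noteq> 1"
  shows "exp (\<Sum>w\<in>#W. Ln (1 - w * z)) = (\<Prod>w\<in>#W. 1 - w * z)"
  using assms by (induction W) (auto simp: exp_add eq_commute[of 1])

text \<open>The power sums are the Taylor coefficients of \<open>ln (h/h(0))\<close>, whose real part is bounded above.
  A single lower bound for \<open>|h|\<close> near the origin bounds \<open>|h(0)|\<close> from below.\<close>

lemma power_sum_bound:
  assumes W: "\<And>w. w \<in># W \<Longrightarrow> cmod w \<le> 2"
    and up: "\<And>z. cmod z < 1/2 \<Longrightarrow> cmod (c * (\<Prod>w\<in>#W. 1 - w * z)) \<le> B"
    and low: "b \<le> cmod (c * (\<Prod>w\<in>#W. 1 - w * z0))" "cmod z0 \<le> 1/10" "0 < b"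
  shows "cmod (\<Sum>w\<in>#W. w ^ Suc k) \<le> Suc k * 10 ^ Suc k * (ln B - ln b + 1)"
proof -
  define f where "f = (\<lambda>z. \<Sum>w\<in>#W. Ln (1 - w * z))"
  have holf: "f holomorphic_on ball 0 (1/2)"
    unfolding f_def using W by (rule higher_deriv_sum_mset_Ln)
  have f0: "f 0 = 0"
    by (simp add: f_def)
  have c: "c \<noteq> 0"
    using low by auto
  have Bc: "cmod c \<le> B"
    using up[of 0] by simp
  have ne1: "w * z \<noteq> 1" if "w \<in># W" "cmod z < 1/2" for w z
  proof
    assume "w * z = 1"
    then have "cmod w * cmod z = 1"
      by (metis norm_mult norm_one)
    moreover have "cmod w * cmod z \<le> 2 * cmod z"
      using W[OF that(1)] by (intro mult_right_mono) auto
    ultimately show False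
      using that(2) by linarith
  qed
  have Ref: "Re (f z) = ln (cmod (c * (\<Prod>w\<in>#W. 1 - w * z))) - ln (cmod c)"
    and pos: "cmod (c * (\<Prod>w\<in>#W. 1 - w * z)) > 0" if "cmod z < 1/2" for z
  proof -
    have "exp (f z) = (\<Prod>w\<in>#W. 1 - w * z)"
      unfolding f_def using ne1 that by (intro exp_sum_mset_Ln) auto
    then have "cmod (c * (\<Prod>w\<in>#W. 1 - w * z)) = cmod c * exp (Re (f z))"
      by (metis norm_mult norm_exp_eq_Re)
    then show "Re (f z) = ln (cmod (c * (\<Prod>w\<in>#W. 1 - w * z))) - ln (cmod c)"
      "cmod (c * (\<Prod>w\<in>#W. 1 - w * z)) > 0"
      using c by (simp_all add: ln_mult)
  qed
  \<comment> \<open>The summand 1 makes Re f < M strict and M positive, even if B = |c|.\<close>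
  define M where "M = ln B - ln (cmod c) + 1"
  have "ln (cmod c) \<le> ln B"
    using Bc c by (intro ln_mono) auto
  then have M: "M > 0"
    by (simp add: M_def)
  have ReM: "Re (f z) < M" if "cmod z < 1/2" for z
  proof -
    have "ln (cmod (c * (\<Prod>w\<in>#W. 1 - w * z))) \<le> ln B"
      using up[OF that] pos[OF that] by (intro ln_mono) auto
    then show ?thesis
      using Ref[OF that] by (simp add: M_def)
  qed
  \<comment> \<open>The radius 1/10 makes the factor 2 * (1/10) / (1/2 - 1/10) equal to 1/2. Being
    below 1, it lets the bound at z0 be solved for M: there ln b <= ln |c| + M/2, while M = ln B -
    ln |c| + 1.\<close>
  have f_le: "cmod (f z) \<le> M / 2" if "cmod z \<le> 1/10" for z
  proof -
    have "cmod (f z) \<le> 2 * M * cmod z / (1/2 - cmod z)"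
      using that by (intro Borel_Caratheodory holf f0 ReM) auto
    also have "\<dots> \<le> 2 * M * (1/10) / (1/2 - 1/10)"
      using that M by (intro frac_le mult_left_mono mult_nonneg_nonneg) auto
    finally show ?thesis
      by simp
  qed
  have "ln b \<le> ln (cmod (c * (\<Prod>w\<in>#W. 1 - w * z0)))"
    using low by (intro ln_mono) auto
  also have "\<dots> \<le> ln (cmod c) + M / 2"
    using Ref[of z0] f_le[OF low(2)] complex_Re_le_cmod[of "f z0"] low(2) by simp
  finally have M_le: "M / 2 \<le> ln B - ln b + 1"
    unfolding M_def by (simp add: field_simps)
  have sub: "ball 0 (1/10) \<subseteq> ball 0 (1/2 :: real)" "cball 0 (1/10) \<subseteq> ball (0::complex) (1/2)"
    by auto
  have "cmod ((deriv ^^ Suc k) f 0) \<le> fact (Suc k) * (M / 2) / (1/10) ^ Suc k"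
  proof (rule Cauchy_inequality)
    show "f holomorphic_on ball 0 (1/10)"
      by (rule holomorphic_on_subset[OF holf]) auto
    show "continuous_on (cball 0 (1/10)) f"
      by (rule holomorphic_on_imp_continuous_on, rule holomorphic_on_subset[OF holf sub(2)])
  qed (use f_le in auto)
  also have "\<dots> \<le> fact (Suc k) * (ln B - ln b + 1) / (1/10) ^ Suc k"
    using M_le by (intro divide_right_mono mult_left_mono) auto
  also have "\<dots> = fact k * (Suc k * 10 ^ Suc k * (ln B - ln b + 1))"
    by (simp add: power_divide algebra_simps)
  also have "(deriv ^^ Suc k) f 0 = - (fact k * (\<Sum>w\<in>#W. w ^ Suc k))"
    unfolding f_def using W by (rule higher_deriv_sum_mset_Ln)
  finally show ?thesis
    by (simp only: norm_minus_cancel norm_mult norm_fact mult_le_cancel_left_pos fact_gt_zero)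
qed

text \<open>The reciprocals of the roots after reflecting those in \<open>|z| < 1/2\<close> in the unit circle.\<close>

definition disc_inverse :: "complex \<Rightarrow> complex" where
  "disc_inverse z = (if cmod z < 1/2 then cnj z else 1 / z)"

lemma norm_disc_inverse_le: "cmod (disc_inverse z) \<le> 2"
proof (cases "cmod z < 1/2")
  case False
  then have "1 / cmod z \<le> 1 / (1/2)"
    by (intro divide_left_mono) auto
  with False show ?thesis
    by (simp add: disc_inverse_def norm_divide)
qed (auto simp: disc_inverse_def)

text \<open>\<open>power_sum_bound\<close> is applied to the reflected polynomial h, whose inverse
  roots are the values of \<open>disc_inverse\<close>. Its lower bound at a point of |z| = 1/10 is
  first found for p by Cauchy's estimate, and passes to h because |p| <= |h| on |z| <= 1/2.\<close>

lemma low_flat_power_sum: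
  assumes "low_flat \<epsilon> n p"
  shows "cmod (\<Sum>z\<in>#proots p. disc_inverse z ^ Suc k)
           \<le> Suc k * 10 ^ Suc k * (ln (real n + 1) + 12 * (\<epsilon> * n) + 2)"
proof -
  let ?S = "{#z \<in># proots p. cmod z < 1/2#}" and ?L = "{#z \<in># proots p. \<not> cmod z < 1/2#}"
  let ?B = "(real n + 1) * exp (\<epsilon> * n)" and ?W = "image_mset disc_inverse (proots p)"
  obtain l where l: "real l \<le> \<epsilon> * n" "exp (-(\<epsilon> * n)) \<le> cmod (coeff p l)"
    using assms(1) by (auto simp: low_flat_def)
  obtain K where "p = smult K ((\<Prod>z\<in>#?S. [:-z, 1:]) * (\<Prod>z\<in>#?L. [:1, -(1/z):]))"
    using low_flat_nonzero[OF assms(1)] by (rule factorization_at_radius[of p "1/2"]) auto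
  then have p: "p = (\<Prod>z\<in>#?S. [:-z, 1:]) * smult K (\<Prod>z\<in>#?L. [:1, -(1/z):])"
    by simp
  define h where "h = (\<Prod>z\<in>#?S. [:1, -cnj z:]) * smult K (\<Prod>z\<in>#?L. [:1, -(1/z):])"
  have B: "cmod (poly p z) \<le> ?B" if "cmod z = 1" for z
    using assms(1) that by (intro norm_poly_le_card_coeffs) (auto simp: low_flat_def)
  have h_up: "cmod (poly h z) \<le> ?B" if "cmod z \<le> 1" for z
    unfolding h_def by (rule reflect_small_roots(1)[where \<rho> = "1/2", OF _ _ _ p B]) (use that in auto)
  have h_low: "cmod (poly p z) \<le> cmod (poly h z)" if "cmod z \<le> 1/2" for z
  proof -
    have "cmod (poly p z) \<le> blaschke_gain (1/2) ^ size ?S * cmod (poly h z)"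
      unfolding h_def by (rule reflect_small_roots(2)[where \<rho> = "1/2", OF _ _ _ p B]) (use that in auto)
    also have "\<dots> \<le> 1 * cmod (poly h z)"
      using blaschke_gain[of "1/2"] by (intro mult_right_mono) (auto simp: power_le_one)
    finally show ?thesis
      by simp
  qed
  have h_eq: "poly h z = K * (\<Prod>w\<in>#?W. 1 - w * z)" for z
  proof -
    have "?W = image_mset disc_inverse (?S + ?L)"
      by simp
    also have "\<dots> = image_mset cnj ?S + image_mset (\<lambda>z. 1 / z) ?L"
      unfolding image_mset_union
      by (intro arg_cong2[where f = "(+)"] image_mset_cong) (auto simp: disc_inverse_def)
    finally have "(\<Prod>w\<in>#?W. 1 - w * z) =
        (\<Prod>w\<in>#?S. 1 - cnj w * z) * (\<Prod>w\<in>#?L. 1 - 1 / w * z)"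
      by (simp only: image_mset_union prod_mset.union image_mset.compositionality o_def)
    then show ?thesis
      by (simp add: h_def poly_prod_mset mult_ac)
  qed
  \<comment> \<open>Half of the coefficient term: if |p| stayed below \<open>?b\<close> on the whole
    circle, Cauchy's estimate would bound that term by half of itself.\<close>
  let ?b = "cmod (coeff p l) * (1/10) ^ l / 2"
  have coeff_pos: "0 < cmod (coeff p l)"
    using l(2) exp_gt_zero by (rule less_le_trans[rotated])
  then have b: "0 < ?b"
    by simp
  have "\<exists>z. cmod z = 1/10 \<and> ?b \<le> cmod (poly p z)"
  proof (rule ccontr)
    assume "\<not> ?thesis"
    then have "cmod (coeff p l) * (1/10) ^ l \<le> ?b"
      by (intro norm_coeff_le) force+
    with b show False
      by simp
  qed
  then obtain z0 where z0: "cmod z0 = 1/10" "?b \<le> cmod (poly p z0)"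
    by blast
  have "cmod (\<Sum>w\<in>#?W. w ^ Suc k) \<le> Suc k * 10 ^ Suc k * (ln ?B - ln ?b + 1)"
  proof (rule power_sum_bound)
    show "?b \<le> cmod (K * (\<Prod>w\<in>#?W. 1 - w * z0))"
      using z0 h_low[of z0] by (simp add: h_eq)
  qed (use h_up h_eq b z0 norm_disc_inverse_le in auto)
  also have "\<dots> \<le> Suc k * 10 ^ Suc k * (ln (real n + 1) + 12 * (\<epsilon> * n) + 2)"
  proof (rule mult_left_mono)
    have "-(\<epsilon> * n) \<le> ln (cmod (coeff p l))"
      using l(2) coeff_pos by (simp add: ln_ge_iff)
    moreover have "ln ?b = ln (cmod (coeff p l)) - real l * ln 10 - ln 2"
      using coeff_pos by (simp add: ln_mult ln_div ln_realpow)
    \<comment> \<open>From ln x <= x - 1. Together with one \<epsilon> n from the upper bound and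
      one from the coefficient this makes 11 \<epsilon> n, rounded up to 12.\<close>
    moreover have "real l * ln 10 \<le> (\<epsilon> * n) * 9"
      using l(1) ln_le_minus_one[of 10] by (intro mult_mono) auto
    moreover have "ln (2::real) \<le> 1"
      using ln_le_minus_one[of 2] by simp
    moreover have "0 \<le> \<epsilon> * n"
      using l(1) of_nat_0_le_iff[of l, where 'a = real] by linarith
    ultimately show "ln ?B - ln ?b + 1 \<le> ln (real n + 1) + 12 * (\<epsilon> * n) + 2"
      by (simp add: ln_mult)
  qed auto
  finally show ?thesis
    by (simp add: image_mset.compositionality o_def)
qed

section \<open>Reversal and the two-sided condition\<close>

text \<open>Reversal is multiplicative, so linear factors suffice. The factor of a root at 0
  reverses to the constant 1, so such roots disappear.\<close>

lemma proots_reflect_poly: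
  fixes p :: "complex poly"
  shows "proots (reflect_poly p) = image_mset inverse {#z \<in># proots p. z \<noteq> 0#}"
proof (cases "p = 0")
  case False
  have lin: "proots (reflect_poly [:-z, 1:]) = (if z = 0 then {#} else {#inverse z#})" for z :: complex
  proof (cases "z = 0")
    case False
    have "reflect_poly [:-z, 1:] = smult (-z) [:-inverse z, 1:]"
      using False by (simp add: reflect_poly_def)
    then show ?thesis
      using False by (simp only: proots_smult proots_linear_factor minus_minus if_False neg_equal_0_iff_equal simp_thms)
  qed (simp add: reflect_poly_def)
  have nz: "reflect_poly (\<Prod>z\<in>#A. [:-z, 1:] :: complex poly) \<noteq> 0" for A
    by (auto simp: prod_mset_zero_iff)
  have "proots (reflect_poly (\<Prod>z\<in>#A. [:-z, 1:])) = image_mset inverse {#z \<in># A. z \<noteq> 0#}" for A :: "complex multiset"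
  proof (induction A)
    case (add z A)
    have "reflect_poly [:-z, 1:] \<noteq> 0"
      by simp
    then have "proots (reflect_poly [:-z, 1:] * reflect_poly (\<Prod>z\<in>#A. [:-z, 1:])) =
        proots (reflect_poly [:-z, 1:]) + proots (reflect_poly (\<Prod>z\<in>#A. [:-z, 1:]))"
      using nz by (rule proots_mult)
    then show ?case
      unfolding image_mset_add_mset prod_mset.add_mset reflect_poly_mult lin add by simp
  qed (simp flip: one_pCons)
  moreover have "reflect_poly p = smult (lead_coeff p) (reflect_poly (\<Prod>z\<in>#proots p. [:-z, 1:]))"
    using reflect_poly_smult[of "lead_coeff p" "\<Prod>z\<in>#proots p. [:-z, 1:]"]
    by (simp only: complex_poly_decompose_multiset)
  ultimately show ?thesis
    using False by simp
qed simp

definition flat :: "real \<Rightarrow> nat \<Rightarrow> complex poly \<Rightarrow> bool" where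
  "flat \<epsilon> n p \<longleftrightarrow> degree p \<le> n \<and> (\<forall>j. cmod (coeff p j) \<le> exp (\<epsilon> * n)) \<and>
     (\<exists>k. real k \<le> \<epsilon> * n \<and> exp (-(\<epsilon> * n)) \<le> cmod (coeff p k)) \<and>
     (\<exists>l. real n - real l \<le> \<epsilon> * n \<and> exp (-(\<epsilon> * n)) \<le> cmod (coeff p l))"

lemma flat_imp_low_flat: "flat \<epsilon> n p \<Longrightarrow> low_flat \<epsilon> n p"
  by (auto simp: flat_def low_flat_def)

lemma flat_degree:
  assumes "flat \<epsilon> n p"
  shows "degree p \<le> n" "real n - real (degree p) \<le> \<epsilon> * n"
proof -
  obtain l where l: "real n - real l \<le> \<epsilon> * n" "exp (-(\<epsilon> * n)) \<le> cmod (coeff p l)"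
    using assms by (auto simp: flat_def)
  have "coeff p l \<noteq> 0"
    using l(2) less_le_trans[OF exp_gt_zero l(2)] by auto
  then have "l \<le> degree p"
    by (rule le_degree)
  with l show "real n - real (degree p) \<le> \<epsilon> * n"
    by linarith
qed (use assms in \<open>auto simp: flat_def\<close>)

text \<open>Reversal is relative to the degree and not to n: index l moves to
  \<open>degree p - l\<close>, which is at most n - l, so the bound \<epsilon> n survives.\<close>

lemma flat_imp_low_flat_reflect:
  assumes "flat \<epsilon> n p"
  shows "low_flat \<epsilon> n (reflect_poly p)"
proof -
  obtain l where l: "real n - real l \<le> \<epsilon> * n" "exp (-(\<epsilon> * n)) \<le> cmod (coeff p l)"
    using assms by (auto simp: flat_def)
  have "coeff p l \<noteq> 0"
    using l(2) less_le_trans[OF exp_gt_zero l(2)] by auto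
  then have l': "l \<le> degree p"
    by (rule le_degree)
  then have "coeff (reflect_poly p) (degree p - l) = coeff p l"
    by (simp add: coeff_reflect_poly)
  moreover have "real (degree p - l) \<le> \<epsilon> * n"
    using l l' flat_degree[OF assms] by linarith
  moreover have "cmod (coeff (reflect_poly p) j) \<le> exp (\<epsilon> * n)" for j
    using assms by (auto simp: flat_def coeff_reflect_poly)
  moreover have "degree (reflect_poly p) \<le> n"
    using degree_reflect_poly_le[of p] flat_degree(1)[OF assms] by simp
  ultimately show ?thesis
    unfolding low_flat_def using l by metis
qed

section \<open>Asymptotics of the roots of a flat sequence\<close>

text \<open>Flatness at level \<epsilon> gives an error D \<epsilon>, with D independent of
  \<epsilon>, plus a logarithmic remainder d. The level is fixed before i grows.\<close>

lemma tendsto_zero_epsI: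
  fixes a :: "'a \<Rightarrow> 'b::real_normed_vector"
  assumes "\<And>\<epsilon>. \<epsilon> > 0 \<Longrightarrow> eventually (\<lambda>i. norm (a i) \<le> D * \<epsilon> + d i) F"
    and "(d \<longlongrightarrow> 0) F" "D \<ge> 0"
  shows "(a \<longlongrightarrow> 0) F"
proof (rule tendstoI)
  fix e :: real assume e: "e > 0"
  define \<epsilon> where "\<epsilon> = e / (2 * (D + 1))"
  have \<epsilon>: "\<epsilon> > 0" "D * \<epsilon> \<le> e / 2"
    using e assms(3) by (auto simp: \<epsilon>_def field_simps)
  have "eventually (\<lambda>i. d i < e / 2) F"
    using assms(2) e by (intro order_tendstoD) auto
  with assms(1)[OF \<epsilon>(1)] show "eventually (\<lambda>i. dist (a i) 0 < e) F"
    by eventually_elim (use \<epsilon>(2) in auto)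
qed

text \<open>The sizes and polynomials are arbitrary rather than values of one random sequence, so
  that the counterexamples collected in \<open>flat_imp_in_open\<close> form an instance.\<close>

locale flat_sequence =
  fixes N :: "nat \<Rightarrow> nat" and p :: "nat \<Rightarrow> complex poly"
  assumes N: "filterlim N at_top sequentially"
    and flat: "\<And>\<epsilon>. \<epsilon> > 0 \<Longrightarrow> eventually (\<lambda>i. flat \<epsilon> (N i) (p i)) sequentially"
begin

definition avg :: "(complex \<Rightarrow> 'b) \<Rightarrow> nat \<Rightarrow> 'b::real_normed_field" where
  "avg g i = (\<Sum>z\<in>#proots (p i). g z) / of_nat (N i)"

lemma N_pos: "eventually (\<lambda>i. N i > 0) sequentially"
proof -
  have "eventually (\<lambda>i. 1 \<le> N i) sequentially"
    using N unfolding filterlim_at_top by blast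
  then show ?thesis
    by eventually_elim simp
qed

lemma log_over_N: "(\<lambda>i. (ln (real (N i) + 1) + 2) / real (N i)) \<longlonglongrightarrow> 0"
proof -
  have "(\<lambda>n::nat. (ln (real n + 1) + 2) / real n) \<longlonglongrightarrow> 0"
    by real_asymp
  then show ?thesis
    using N by (rule filterlim_compose)
qed

text \<open>The sequence q is free because \<open>large_roots\<close> needs the reversed polynomials
  in its place.\<close>

lemma low_flat_small_roots:
  assumes "\<And>\<epsilon>. \<epsilon> > 0 \<Longrightarrow> eventually (\<lambda>i. low_flat \<epsilon> (N i) (q i)) sequentially" "0 < \<rho>" "\<rho> < 1"
  shows "(\<lambda>i. real (size {#z \<in># proots (q i). cmod z < \<rho>#}) / real (N i)) \<longlonglongrightarrow> 0"
proof (rule tendsto_zero_epsI)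
  let ?c = "- ln (blaschke_gain \<rho>)"
  have c: "?c > 0"
    using blaschke_gain[OF assms(2,3)] by simp
  show "eventually (\<lambda>i. norm (real (size {#z \<in># proots (q i). cmod z < \<rho>#}) / real (N i)) \<le>
      3 / ?c * \<epsilon> + (ln (real (N i) + 1) + 2) / real (N i) / ?c) sequentially"
    if "\<epsilon> > 0" for \<epsilon>
    using assms(1)[OF that] N_pos
  proof eventually_elim
    case (elim i)
    let ?s = "real (size {#z \<in># proots (q i). cmod z < \<rho>#})"
    have "?s * ?c \<le> 3 * (\<epsilon> * N i) + (ln (real (N i) + 1) + 2)"
      using low_flat_size_small_roots[OF elim(1) assms(2,3)] by simp
    then have "?s * ?c / (N i * ?c) \<le> (3 * (\<epsilon> * N i) + (ln (real (N i) + 1) + 2)) / (N i * ?c)"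
      using c by (intro divide_right_mono mult_nonneg_nonneg) auto
    moreover have "?s * ?c / (N i * ?c) = ?s / N i"
      using c by simp
    moreover have "(3 * (\<epsilon> * N i) + (ln (real (N i) + 1) + 2)) / (N i * ?c) =
        3 / ?c * \<epsilon> + (ln (real (N i) + 1) + 2) / N i / ?c"
      using elim(2) unfolding add_divide_distrib[of "3 * (\<epsilon> * N i)"] by simp
    ultimately show ?case
      by simp
  qed
  show "(\<lambda>i. (ln (real (N i) + 1) + 2) / real (N i) / ?c) \<longlonglongrightarrow> 0"
    using tendsto_divide[OF log_over_N tendsto_const[of ?c]] c by simp
  show "0 \<le> 3 / ?c"
    using c by simp
qed

lemma small_roots:
  assumes "0 < \<rho>" "\<rho> < 1"
  shows "(\<lambda>i. real (size {#z \<in># proots (p i). cmod z < \<rho>#}) / real (N i)) \<longlonglongrightarrow> 0"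
  using assms by (intro low_flat_small_roots eventually_mono[OF flat] flat_imp_low_flat)

lemma large_roots:
  assumes "0 < \<rho>" "\<rho> < 1"
  shows "(\<lambda>i. real (size {#z \<in># proots (p i). 1 / \<rho> < cmod z#}) / real (N i)) \<longlonglongrightarrow> 0"
proof -
  have "size {#w \<in># proots (reflect_poly q). cmod w < \<rho>#} = size {#z \<in># proots q. 1 / \<rho> < cmod z#}"
    for q :: "complex poly"
  proof -
    have "{#z \<in># proots q. z \<noteq> 0 \<and> cmod (inverse z) < \<rho>#} = {#z \<in># proots q. 1 / \<rho> < cmod z#}"
    proof (intro filter_mset_cong refl iffI conjI)
      fix z :: complex
      show "1 / \<rho> < cmod z" if "z \<noteq> 0 \<and> cmod (inverse z) < \<rho>"
        using conjunct1[OF that] conjunct2[OF that] assms by (simp add: norm_divide field_simps)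
      assume z: "1 / \<rho> < cmod z"
      moreover have "0 < 1 / \<rho>"
        using assms by simp
      ultimately show "z \<noteq> 0"
        by auto
      with z show "cmod (inverse z) < \<rho>"
        using assms by (simp add: norm_divide field_simps)
    qed
    then show ?thesis
      by (simp add: proots_reflect_poly filter_mset_image_mset filter_filter_mset)
  qed
  moreover have "(\<lambda>i. real (size {#z \<in># proots (reflect_poly (p i)). cmod z < \<rho>#}) / real (N i)) \<longlonglongrightarrow> 0"
    using assms by (intro low_flat_small_roots eventually_mono[OF flat] flat_imp_low_flat_reflect)
  ultimately show ?thesis
    by simp
qed

lemma number_of_roots: "(\<lambda>i. real (size (proots (p i))) / real (N i)) \<longlonglongrightarrow> 1"
proof -
  have "(\<lambda>i. 1 - real (size (proots (p i))) / real (N i)) \<longlonglongrightarrow> 0"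
  proof (rule tendsto_zero_epsI[where D = 1 and d = "\<lambda>_. 0"])
    show "eventually (\<lambda>i. norm (1 - real (size (proots (p i))) / real (N i)) \<le> 1 * \<epsilon> + 0) sequentially"
      if "\<epsilon> > 0" for \<epsilon>
      using flat[OF that] N_pos
    proof eventually_elim
      case (elim i)
      have "1 - real (degree (p i)) / real (N i) \<le> \<epsilon>" "real (degree (p i)) / real (N i) \<le> 1"
        using flat_degree[OF elim(1)] elim(2) by (auto simp: field_simps)
      then show ?case
        by (simp add: size_proots_complex)
    qed
  qed auto
  from tendsto_diff[OF tendsto_const[of 1] this] show ?thesis
    by simp
qed

lemma power_sums: "avg (\<lambda>z. disc_inverse z ^ Suc k) \<longlonglongrightarrow> 0"
proof (rule tendsto_zero_epsI)
  let ?C = "real (Suc k * 10 ^ Suc k)"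
  show "eventually (\<lambda>i. norm (avg (\<lambda>z. disc_inverse z ^ Suc k) i) \<le>
      ?C * 12 * \<epsilon> + ?C * ((ln (real (N i) + 1) + 2) / real (N i))) sequentially"
    if "\<epsilon> > 0" for \<epsilon>
    using flat[OF that] N_pos
  proof eventually_elim
    case (elim i)
    have "cmod (\<Sum>z\<in>#proots (p i). disc_inverse z ^ Suc k) / N i
        \<le> ?C * (ln (real (N i) + 1) + 12 * (\<epsilon> * N i) + 2) / N i"
      by (intro divide_right_mono low_flat_power_sum flat_imp_low_flat elim) auto
    also have "\<dots> = ?C * 12 * \<epsilon> + ?C * ((ln (real (N i) + 1) + 2) / real (N i))"
      using elim(2) by (simp add: field_simps del: power_Suc)
    finally show ?case
      by (simp only: avg_def norm_divide norm_of_nat)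
  qed
  show "(\<lambda>i. ?C * ((ln (real (N i) + 1) + 2) / real (N i))) \<longlonglongrightarrow> 0"
    using tendsto_mult_right_zero[OF log_over_N] by blast
qed auto

text \<open>All but o(N) roots lie in any given annulus around the unit circle. There u is at most
  \<eta>; the other roots contribute at most B each, so their share vanishes in the limit.\<close>

lemma eventually_avg_le:
  fixes u :: "complex \<Rightarrow> 'b::real_normed_field"
  assumes B: "\<And>z. norm (u z) \<le> B" and \<delta>: "\<delta> > 0" and \<eta>: "\<eta> > 0"
    and u: "\<And>z. \<bar>cmod z - 1\<bar> < \<delta> \<Longrightarrow> norm (u z) \<le> \<eta>"
  shows "eventually (\<lambda>i. norm (avg u i) < 2 * \<eta>) sequentially"
proof -
  \<comment> \<open>With this value 1/\<rho> = 1 + \<delta>/2 and \<rho> > 1 - \<delta>, so roots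
    that are neither small nor large for \<rho> lie in the annulus of half-width \<delta>.\<close>
  define \<rho> where "\<rho> = 1 / (1 + \<delta> / 2)"
  have \<rho>: "0 < \<rho>" "\<rho> < 1"
    using \<delta> by (auto simp: \<rho>_def)
  have ann: "\<bar>cmod z - 1\<bar> < \<delta>" if "\<not> cmod z < \<rho>" "\<not> 1 / \<rho> < cmod z" for z
  proof -
    have "(1 - \<delta>) * (1 + \<delta> / 2) < 1"
      using \<delta> by (simp add: algebra_simps add_pos_pos)
    then have "1 - \<delta> < \<rho>"
      using \<delta> by (simp add: \<rho>_def pos_less_divide_eq)
    moreover have "1 / \<rho> = 1 + \<delta> / 2"
      by (simp add: \<rho>_def)
    ultimately show ?thesis
      using that \<delta> by linarith
  qed
  let ?s = "\<lambda>i. real (size {#z \<in># proots (p i). cmod z < \<rho>#})"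
  let ?l = "\<lambda>i. real (size {#z \<in># proots (p i). 1 / \<rho> < cmod z#})"
  have B0: "0 \<le> B"
    using order_trans[OF norm_ge_zero B] .
  have sum: "norm (\<Sum>z\<in>#A. u z) \<le> \<eta> * size A + B * size {#z \<in># A. cmod z < \<rho>#} +
      B * size {#z \<in># A. 1 / \<rho> < cmod z#}" for A
  proof (induction A)
    case (add z A)
    have "norm (u z) \<le> \<eta> + (if cmod z < \<rho> then B else 0) + (if 1 / \<rho> < cmod z then B else 0)"
      using B[of z] u[OF ann, of z] \<eta> B0 by auto
    then have "norm (u z + (\<Sum>z\<in>#A. u z)) \<le> \<eta> + (if cmod z < \<rho> then B else 0) +
        (if 1 / \<rho> < cmod z then B else 0) + (\<eta> * size A + B * size {#z \<in># A. cmod z < \<rho>#} +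
      B * size {#z \<in># A. 1 / \<rho> < cmod z#})"
      using add by (intro order_trans[OF norm_triangle_ineq add_mono])
    then show ?case
      by (simp add: algebra_simps split: if_splits)
  qed auto
  have "(\<lambda>i. \<eta> * (real (size (proots (p i))) / real (N i)) + B * (?s i / N i) + B * (?l i / N i))
      \<longlonglongrightarrow> \<eta> * 1 + B * 0 + B * 0"
    by (intro tendsto_intros number_of_roots small_roots large_roots \<rho>)
  then have "eventually (\<lambda>i. \<eta> * (real (size (proots (p i))) / real (N i)) + B * (?s i / N i) +
      B * (?l i / N i) < 2 * \<eta>) sequentially"
    using \<eta> by (intro order_tendstoD) auto
  then show ?thesis
  proof eventually_elim
    case (elim i)
    have "norm (avg u i) \<le> (\<eta> * size (proots (p i)) + B * ?s i + B * ?l i) / N i"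
      unfolding avg_def norm_divide norm_of_nat by (intro divide_right_mono sum) auto
    with elim show ?case
      by (simp add: add_divide_distrib)
  qed
qed

lemma avg_tendsto_zero:
  fixes u :: "complex \<Rightarrow> 'b::real_normed_field"
  assumes B: "\<And>z. norm (u z) \<le> B"
    and u: "\<And>\<eta>. \<eta> > 0 \<Longrightarrow> \<exists>\<delta>>0. \<forall>z. \<bar>cmod z - 1\<bar> < \<delta> \<longrightarrow> norm (u z) \<le> \<eta>"
  shows "avg u \<longlonglongrightarrow> 0"
proof (rule tendstoI)
  fix e :: real assume "e > 0"
  then obtain \<delta> where "\<delta> > 0" "\<And>z. \<bar>cmod z - 1\<bar> < \<delta> \<Longrightarrow> norm (u z) \<le> e / 2"
    using u[of "e / 2"] by auto
  from eventually_avg_le[OF B this(1) _ this(2)] \<open>e > 0\<close>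
  show "eventually (\<lambda>i. dist (avg u i) 0 < e) sequentially"
    by simp
qed

lemma avg_diff: "avg (\<lambda>z. f z - g z) i = avg f i - avg g i"
proof -
  have "(\<Sum>z\<in>#A. f z - g z) = (\<Sum>z\<in>#A. f z) - (\<Sum>z\<in>#A. g z)" for A
    by (induction A) auto
  then show ?thesis
    by (simp add: avg_def diff_divide_distrib)
qed

text \<open>For |z| >= 1/2 the number \<open>disc_inverse z\<close> is \<open>cnj (sgn z)\<close>
  divided by |z|, so the two powers agree in the limit |z| = 1. Averages only see the neighbourhood
  of the circle, so the power sums carry over.\<close>

lemma avg_cnj_sgn_power: "avg (\<lambda>z. cnj (sgn z) ^ Suc k) \<longlonglongrightarrow> 0"
proof -
  have "avg (\<lambda>z. disc_inverse z ^ Suc k - cnj (sgn z) ^ Suc k) \<longlonglongrightarrow> 0"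
  proof (rule avg_tendsto_zero)
    fix z
    have "cmod (disc_inverse z ^ Suc k) \<le> 2 ^ Suc k"
      unfolding norm_power by (intro power_mono norm_disc_inverse_le) auto
    moreover have "cmod (cnj (sgn z) ^ Suc k) \<le> 1"
      unfolding norm_power by (intro power_le_one) (auto simp: norm_sgn)
    ultimately show "cmod (disc_inverse z ^ Suc k - cnj (sgn z) ^ Suc k) \<le> 2 ^ Suc k + 1"
      using norm_triangle_ineq4[of "disc_inverse z ^ Suc k" "cnj (sgn z) ^ Suc k"] by linarith
  next
    fix \<eta> :: real assume "\<eta> > 0"
    have "((\<lambda>r::real. (1 / r) ^ Suc k) \<longlongrightarrow> (1 / 1) ^ Suc k) (at 1)"
      by (intro tendsto_intros) auto
    then obtain d where d: "d > 0" "\<And>r. r \<noteq> 1 \<Longrightarrow> \<bar>r - 1\<bar> < d \<Longrightarrow> \<bar>(1 / r) ^ Suc k - 1\<bar> < \<eta>"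
      using \<open>\<eta> > 0\<close> unfolding LIM_eq by (auto simp del: power_Suc)
    show "\<exists>\<delta>>0. \<forall>z. \<bar>cmod z - 1\<bar> < \<delta> \<longrightarrow> cmod (disc_inverse z ^ Suc k - cnj (sgn z) ^ Suc k) \<le> \<eta>"
    \<comment> \<open>The 1/2 keeps z out of the region where \<open>disc_inverse\<close>
      conjugates.\<close>
    proof (intro exI[of _ "min d (1/2)"] conjI allI impI)
      fix z assume z: "\<bar>cmod z - 1\<bar> < min d (1/2)"
      then have z0: "cmod z > 1/2"
        by linarith
      then have "z \<noteq> 0"
        by auto
      have "disc_inverse z = of_real (1 / cmod z) * cnj (sgn z)"
      proof -
        have "z * cnj z = of_real (cmod z) * of_real (cmod z)"
          using complex_norm_square[of z] by (simp add: power2_eq_square)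
        then show ?thesis
          using z0 \<open>z \<noteq> 0\<close> by (simp add: disc_inverse_def sgn_eq divide_simps mult.commute)
      qed
      then have "disc_inverse z ^ Suc k - cnj (sgn z) ^ Suc k =
          of_real ((1 / cmod z) ^ Suc k - 1) * cnj (sgn z) ^ Suc k"
        by (simp only: power_mult_distrib of_real_power of_real_diff of_real_1 left_diff_distrib mult_1_left)
      then have "cmod (disc_inverse z ^ Suc k - cnj (sgn z) ^ Suc k) = \<bar>(1 / cmod z) ^ Suc k - 1\<bar>"
        using \<open>z \<noteq> 0\<close> by (simp only: norm_mult norm_power complex_mod_cnj norm_of_real norm_sgn) simp
      also have "\<dots> \<le> \<eta>"
        using d(2)[of "cmod z"] z \<open>\<eta> > 0\<close> by (cases "cmod z = 1") (auto simp del: power_Suc)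
      finally show "cmod (disc_inverse z ^ Suc k - cnj (sgn z) ^ Suc k) \<le> \<eta>" .
    qed (use d in auto)
  qed
  from tendsto_diff[OF power_sums[of k] this] show ?thesis
    by (simp add: avg_diff del: power_Suc)
qed

end

section \<open>Trigonometric polynomials and integrals on the circle\<close>

text \<open>Values are prescribed on the unit circle only, so the class is closed under products,
  whose reduction uses cnj z * z = 1. Exponents k >= 0 suffice, because Re (c z^k) = Re (cnj c (cnj
  z)^k). Powers of \<open>cnj z\<close> match \<open>avg_cnj_sgn_power\<close>.\<close>

inductive trig_poly :: "(complex \<Rightarrow> real) \<Rightarrow> bool" where
  monomial: "(\<And>z. cmod z = 1 \<Longrightarrow> f z = Re (c * cnj z ^ k)) \<Longrightarrow> trig_poly f"
| add: "trig_poly f \<Longrightarrow> trig_poly g \<Longrightarrow> (\<And>z. cmod z = 1 \<Longrightarrow> h z = f z + g z) \<Longrightarrow> trig_poly h"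

text \<open>By 2 Re a Re b = Re (a b) + Re (a cnj b), the exponents are k + l and k - l. If k - l is
  negative, conjugation turns it into l - k without changing the real part.\<close>

lemma trig_poly_monomial_mult:
  assumes f: "\<And>z. cmod z = 1 \<Longrightarrow> f z = Re (c * cnj z ^ k)"
    and g: "\<And>z. cmod z = 1 \<Longrightarrow> g z = Re (d * cnj z ^ l)"
  shows "trig_poly (\<lambda>z. f z * g z)"
proof -
  have Re_mult: "Re a * Re b = Re (a * b / 2) + Re (a * cnj b / 2)" for a b
    by (simp add: field_simps)
  have unit: "cnj z * z = 1" if "cmod z = 1" for z
    using complex_norm_square[of z] that by (simp add: mult.commute)
  have "trig_poly (\<lambda>z. Re ((c * d / 2) * cnj z ^ (k + l)))"
    by (rule trig_poly.monomial) (rule refl)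
  moreover have "trig_poly (\<lambda>z. Re ((c * cnj z ^ k) * cnj (d * cnj z ^ l) / 2))"
  proof (cases "l \<le> k")
    case True
    show ?thesis
    proof (rule trig_poly.monomial)
      fix z :: complex assume z: "cmod z = 1"
      have "cnj z ^ k * z ^ l = cnj z ^ (k - l) * (cnj z * z) ^ l"
        using True by (simp add: power_mult_distrib flip: power_add mult.assoc)
      then show "Re ((c * cnj z ^ k) * cnj (d * cnj z ^ l) / 2) = Re ((c * cnj d / 2) * cnj z ^ (k - l))"
        using unit[OF z] by (simp add: mult_ac)
    qed
  next
    case False
    show ?thesis
    proof (rule trig_poly.monomial)
      fix z :: complex assume z: "cmod z = 1"
      have "z ^ k * cnj z ^ l = cnj z ^ (l - k) * (cnj z * z) ^ k"
        using False by (simp add: power_mult_distrib mult_ac flip: power_add)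
      then have "cnj ((c * cnj z ^ k) * cnj (d * cnj z ^ l) / 2) = (cnj c * d / 2) * cnj z ^ (l - k)"
        using unit[OF z] by (simp add: mult_ac)
      then show "Re ((c * cnj z ^ k) * cnj (d * cnj z ^ l) / 2) = Re ((cnj c * d / 2) * cnj z ^ (l - k))"
        by (metis cnj.sel(1))
    qed
  qed
  ultimately show ?thesis
    by (rule trig_poly.add) (simp only: f g Re_mult power_add mult_ac times_divide_eq_left times_divide_eq_right)
qed

lemma trig_poly_mult:
  assumes "trig_poly f" "trig_poly g"
  shows "trig_poly (\<lambda>z. f z * g z)"
  using assms(1)
proof induction
  case (monomial f c k)
  show ?case
    using assms(2)
  proof induction
    case (monomial g d l)
    with \<open>\<And>z. cmod z = 1 \<Longrightarrow> f z = Re (c * cnj z ^ k)\<close> show ?case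
      by (rule trig_poly_monomial_mult)
  next
    case (add g1 g2 g)
    show ?case
      by (rule trig_poly.add[OF add.IH]) (simp add: add.hyps algebra_simps)
  qed
next
  case (add f1 f2 f)
  show ?case
    by (rule trig_poly.add[OF add.IH]) (simp add: add.hyps algebra_simps)
qed

lemma trig_poly_continuous_on:
  assumes "trig_poly f"
  shows "continuous_on (sphere 0 1) f"
  using assms
proof induction
  case (monomial f c k)
  have "continuous_on (sphere 0 1) (\<lambda>z. Re (c * cnj z ^ k))"
    by (intro continuous_intros)
  then show ?case
    by (rule continuous_on_eq) (use monomial in auto)
next
  case (add f g h)
  show ?case
    by (rule continuous_on_eq[OF continuous_on_add[OF add.IH]]) (use add in auto)
qed

lemma trig_poly_dense:
  fixes f :: "complex \<Rightarrow> real"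
  assumes "continuous_on (sphere 0 1) f" "e > 0"
  shows "\<exists>g. trig_poly g \<and> (\<forall>z\<in>sphere 0 1. \<bar>f z - g z\<bar> < e)"
proof -
  interpret function_ring_on "{f. trig_poly f}" "sphere (0::complex) 1"
  proof
    fix f g assume "f \<in> {f. trig_poly f}" "g \<in> {f. trig_poly f}"
    then show "(\<lambda>x. f x + g x) \<in> {f. trig_poly f}" "(\<lambda>x. f x * g x) \<in> {f. trig_poly f}"
      by (auto intro: trig_poly.add trig_poly_mult)
  next
    fix c :: real
    show "(\<lambda>_. c) \<in> {f. trig_poly f}"
      using trig_poly.monomial[of "\<lambda>_. c" "of_real c" 0] by simp
  next
    fix x y :: complex assume "x \<noteq> y"
    \<comment> \<open>The coefficients 1 and i give the real and the imaginary part, which together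
      separate points.\<close>
    then have "Re (1 * cnj x ^ 1) \<noteq> Re (1 * cnj y ^ 1) \<or> Re (\<i> * cnj x ^ 1) \<noteq> Re (\<i> * cnj y ^ 1)"
      by (auto simp: complex_eq_iff)
    moreover have "(\<lambda>z. Re (c * cnj z ^ 1)) \<in> {f. trig_poly f}" for c
      by (rule CollectI, rule trig_poly.monomial, rule refl)
    ultimately show "\<exists>f\<in>{f. trig_poly f}. f x \<noteq> f y"
      by metis
  qed (auto intro: trig_poly_continuous_on)
  show ?thesis
    using Stone_Weierstrass_basic[OF assms] by auto
qed

abbreviation angle_measure :: "real measure" where
  "angle_measure \<equiv> uniform_measure lborel {0..2 * pi}"

lemma prob_space_angle_measure: "prob_space angle_measure"
  by (rule prob_space_uniform_measure) auto

lemma integral_angle_measure: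
  fixes g :: "real \<Rightarrow> real"
  assumes [measurable]: "g \<in> borel_measurable borel"
  shows "(\<integral>t. g t \<partial>angle_measure) = (\<integral>t. indicator {0..2 * pi} t *\<^sub>R g t \<partial>lborel) / (2 * pi)"
proof -
  have "angle_measure = density lborel (\<lambda>t. ennreal (indicator {0..2 * pi} t / (2 * pi)))"
  proof -
    have "1 / ennreal (2 * pi) = ennreal (1 / (2 * pi))"
      using divide_ennreal[of 1 "2 * pi"] by simp
    then show ?thesis
      unfolding uniform_measure_def by (intro density_cong) (auto simp: indicator_def)
  qed
  then show ?thesis
    by (simp add: integral_density)
qed

lemma integrable_continuous_cis:
  assumes "continuous_on (sphere 0 1) g"
  shows "integrable angle_measure (\<lambda>t. g (cis t) :: real)"
proof -
  interpret prob_space angle_measure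
    by (rule prob_space_angle_measure)
  have "continuous_on UNIV (\<lambda>t. g (cis t))"
    by (rule continuous_on_compose2[OF assms]) (auto intro!: continuous_intros)
  then have m: "(\<lambda>t. g (cis t)) \<in> borel_measurable borel"
    by (rule borel_measurable_continuous_onI)
  have "\<exists>B. \<forall>z\<in>sphere 0 1. \<bar>g z\<bar> \<le> B"
    using compact_imp_bounded[OF compact_continuous_image[OF assms]] by (simp add: bounded_iff)
  then obtain B where "\<forall>z\<in>sphere 0 1. \<bar>g z\<bar> \<le> B" ..
  then show ?thesis
    using m by (intro integrable_const_bound[where B = B]) (auto simp: measurable_def)
qed

lemma integral_circle_measure:
  fixes f :: "complex \<Rightarrow> real"
  assumes "continuous_on UNIV f"
  shows "(\<integral>z. f z \<partial>circle_measure) = (\<integral>t. f (cis t) \<partial>angle_measure)"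
proof -
  have "cis \<in> borel_measurable borel"
    by (auto intro!: borel_measurable_continuous_onI continuous_intros)
  then have "cis \<in> measurable angle_measure borel"
    by (simp add: measurable_def)
  moreover have "f \<in> borel_measurable borel"
    using assms by (rule borel_measurable_continuous_onI)
  ultimately show ?thesis
    unfolding circle_measure_def by (rule integral_distr)
qed

lemma integral_trig_monomial:
  "(\<integral>t. Re (c * cnj (cis t) ^ Suc k) \<partial>angle_measure) = 0"
proof -
  let ?k = "real (Suc k)"
  have "Re (c * cnj (cis t) ^ Suc k) = Re c * cos (?k * t) + Im c * sin (?k * t)" for t
  proof -
    have "cnj (cis t) ^ Suc k = cis (?k * - t)"
      by (simp only: cis_cnj Complex.DeMoivre)
    then show ?thesis
      by (simp del: power_Suc of_nat_Suc)
  qed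
  then have "(\<integral>t. Re (c * cnj (cis t) ^ Suc k) \<partial>angle_measure) =
      (\<integral>t. indicator {0..2 * pi} t *\<^sub>R (Re c * cos (?k * t) + Im c * sin (?k * t)) \<partial>lborel) / (2 * pi)"
    by (subst integral_angle_measure)
      (auto intro!: borel_measurable_continuous_onI continuous_intros simp del: power_Suc of_nat_Suc)
  also have "(\<integral>t. indicator {0..2 * pi} t *\<^sub>R (Re c * cos (?k * t) + Im c * sin (?k * t)) \<partial>lborel) =
      (Re c * sin (?k * (2 * pi)) - Im c * cos (?k * (2 * pi))) / ?k - (Re c * sin (?k * 0) - Im c * cos (?k * 0)) / ?k"
  proof (rule integral_FTC_Icc[where F = "\<lambda>t. (Re c * sin (?k * t) - Im c * cos (?k * t)) / ?k"])
    fix t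
    have "((\<lambda>t. (Re c * sin (?k * t) - Im c * cos (?k * t)) / ?k) has_real_derivative
        Re c * cos (?k * t) + Im c * sin (?k * t)) (at t within {0..2 * pi})"
      by (auto intro!: derivative_eq_intros simp del: of_nat_Suc simp: field_simps)
    then show "((\<lambda>t. (Re c * sin (?k * t) - Im c * cos (?k * t)) / ?k) has_vector_derivative
        Re c * cos (?k * t) + Im c * sin (?k * t)) (at t within {0..2 * pi})"
      by (simp only: has_real_derivative_iff_has_vector_derivative)
  qed (auto intro!: continuous_intros)
  finally show ?thesis
    using sin_int_2pin[of "int (Suc k)"] cos_int_2pin[of "int (Suc k)"]
    by (simp add: mult_ac del: of_nat_Suc)
qed

section \<open>Convergence of root averages to the circle measure\<close>

context flat_sequence
begin

lemma avg_add: "avg (\<lambda>z. f z + g z) i = avg f i + avg g i"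
  by (simp add: avg_def sum_mset.distrib add_divide_distrib)

lemma avg_Re_mult: "avg (\<lambda>z. Re (c * f z)) i = Re (c * avg f i)"
proof -
  have "(\<Sum>z\<in>#A. Re (c * f z)) = Re (c * (\<Sum>z\<in>#A. f z))" for A
    by (induction A) (auto simp: algebra_simps)
  then show ?thesis
    by (simp add: avg_def)
qed

text \<open>\<open>sgn 0\<close> is 0, off the circle, where a \<open>trig_poly\<close> is
  unconstrained. The roots at 0 are negligible in number, so changing a function there does not
  affect the limit.\<close>

lemma avg_eq_off_zero:
  assumes "\<And>z. z \<noteq> 0 \<Longrightarrow> f z = (g z :: real)"
  shows "(\<lambda>i. avg f i - avg g i) \<longlonglongrightarrow> 0"
proof -
  have "avg (\<lambda>z. f z - g z) \<longlonglongrightarrow> 0"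
  proof (rule avg_tendsto_zero)
    show "norm (f z - g z) \<le> norm (f 0 - g 0)" for z
    proof (cases "z = 0")
      case False
      then have "f z = g z"
        by (rule assms)
      then show ?thesis
        by simp
    qed simp
    show "\<exists>\<delta>>0. \<forall>z. \<bar>cmod z - 1\<bar> < \<delta> \<longrightarrow> norm (f z - g z) \<le> \<eta>" if "\<eta> > 0" for \<eta>
    proof (intro exI[of _ 1] conjI allI impI)
      fix z assume "\<bar>cmod z - 1\<bar> < 1"
      then have "z \<noteq> 0"
        by auto
      then have "f z = g z"
        by (rule assms)
      then show "norm (f z - g z) \<le> \<eta>"
        using that by simp
    qed simp
  qed
  moreover have "avg (\<lambda>z. f z - g z) = (\<lambda>i. avg f i - avg g i)"
    by (rule ext) (rule avg_diff)
  ultimately show ?thesis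
    by (simp only:)
qed

lemma avg_trig_poly:
  assumes "trig_poly f"
  shows "avg (\<lambda>z. f (sgn z)) \<longlonglongrightarrow> (\<integral>t. f (cis t) \<partial>angle_measure)"
  using assms
proof induction
  case (monomial f c k)
  have diff: "(\<lambda>i. avg (\<lambda>z. f (sgn z)) i - avg (\<lambda>z. Re (c * cnj (sgn z) ^ k)) i) \<longlonglongrightarrow> 0"
    by (intro avg_eq_off_zero) (rule monomial, simp add: norm_sgn)
  have lim: "avg (\<lambda>z. Re (c * cnj (sgn z) ^ k)) \<longlonglongrightarrow> (\<integral>t. Re (c * cnj (cis t) ^ k) \<partial>angle_measure)"
  proof (cases k)
    case 0
    have "(\<lambda>i. Re c * (real (size (proots (p i))) / real (N i))) \<longlonglongrightarrow> Re c * 1"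
      by (intro tendsto_intros number_of_roots)
    then show ?thesis
      using 0 prob_space.prob_space[OF prob_space_angle_measure]
      by (simp add: avg_def[abs_def] mult.commute)
  next
    case (Suc m)
    have "(\<lambda>i. Re (c * avg (\<lambda>z. cnj (sgn z) ^ Suc m) i)) \<longlonglongrightarrow> Re (c * 0)"
      by (intro tendsto_intros avg_cnj_sgn_power)
    moreover have "avg (\<lambda>z. Re (c * cnj (sgn z) ^ k)) = (\<lambda>i. Re (c * avg (\<lambda>z. cnj (sgn z) ^ Suc m) i))"
      unfolding Suc by (rule ext) (rule avg_Re_mult)
    moreover have "(\<integral>t. Re (c * cnj (cis t) ^ k) \<partial>angle_measure) = Re (c * 0)"
      unfolding Suc integral_trig_monomial by simp
    ultimately show ?thesis
      by (simp only:)
  qed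
  have "avg (\<lambda>z. f (sgn z)) \<longlonglongrightarrow> (\<integral>t. Re (c * cnj (cis t) ^ k) \<partial>angle_measure)"
    by (rule Lim_transform[OF lim diff])
  moreover have "f (cis t) = Re (c * cnj (cis t) ^ k)" for t
    by (rule monomial) simp
  ultimately show ?case
    by (simp only:)
next
  case (add f g h)
  have diff: "(\<lambda>i. avg (\<lambda>z. h (sgn z)) i - avg (\<lambda>z. f (sgn z) + g (sgn z)) i) \<longlonglongrightarrow> 0"
    by (intro avg_eq_off_zero) (simp add: add.hyps norm_sgn)
  have lim: "avg (\<lambda>z. f (sgn z) + g (sgn z)) \<longlonglongrightarrow>
      (\<integral>t. f (cis t) \<partial>angle_measure) + (\<integral>t. g (cis t) \<partial>angle_measure)"
    unfolding avg_add by (intro tendsto_intros add.IH)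
  have "avg (\<lambda>z. h (sgn z)) \<longlonglongrightarrow>
      (\<integral>t. f (cis t) \<partial>angle_measure) + (\<integral>t. g (cis t) \<partial>angle_measure)"
    by (rule Lim_transform[OF lim diff])
  moreover have "integrable angle_measure (\<lambda>t. f (cis t))" "integrable angle_measure (\<lambda>t. g (cis t))"
    by (intro integrable_continuous_cis trig_poly_continuous_on add.hyps)+
  then have "(\<integral>t. f (cis t) + g (cis t) \<partial>angle_measure) =
      (\<integral>t. f (cis t) \<partial>angle_measure) + (\<integral>t. g (cis t) \<partial>angle_measure)"
    by (rule Bochner_Integration.integral_add)
  moreover have "h (cis t) = f (cis t) + g (cis t)" for t
    by (simp add: add.hyps)
  ultimately show ?case
    by (simp only:)
qed

text \<open>f is compared with a trigonometric approximation T evaluated at the radial projection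
  \<open>sgn z\<close>: near the circle by uniform continuity of f, elsewhere by boundedness and the
  scarcity of roots.\<close>

lemma avg_tendsto_circle_measure:
  assumes cont: "continuous_on UNIV f" and "bounded (range f)"
  shows "avg f \<longlonglongrightarrow> (\<integral>z. (f z :: real) \<partial>circle_measure)"
proof (rule tendstoI)
  fix e :: real assume "e > 0"
  \<comment> \<open>The total error is 4 \<eta> for replacing f by T, plus \<eta> for the limit of
    the average of T, plus \<eta> for the integral of T against that of f.\<close>
  define \<eta> where "\<eta> = e / 6"
  have \<eta>: "\<eta> > 0"
    using \<open>e > 0\<close> by (simp add: \<eta>_def)
  obtain B where B: "\<And>z. \<bar>f z\<bar> \<le> B"
    using assms(2) by (auto simp: bounded_iff)
  have cont': "continuous_on (sphere 0 1) f"
    using cont by (rule continuous_on_subset) auto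
  obtain T where T: "trig_poly T" "\<And>z. cmod z = 1 \<Longrightarrow> \<bar>f z - T z\<bar> < \<eta>"
    using trig_poly_dense[OF cont' \<eta>] by auto
  obtain \<delta> where \<delta>: "\<delta> > 0" "\<And>x y. \<lbrakk>x \<in> cball 0 2; y \<in> cball 0 2; dist y x < \<delta>\<rbrakk> \<Longrightarrow> dist (f y) (f x) < \<eta>"
    using compact_uniformly_continuous[OF continuous_on_subset[OF cont, of "cball 0 2"]] \<eta>
    unfolding uniformly_continuous_on_def by (metis compact_cball subset_UNIV)
  have ev1: "eventually (\<lambda>i. norm (avg (\<lambda>z. f z - T (sgn z)) i) < 2 * (2 * \<eta>)) sequentially"
  proof (rule eventually_avg_le)
    fix z :: complex
    \<comment> \<open>T is evaluated only on the circle, where it is \<eta>-close to f, and at 0;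
      hence the term |T 0|.\<close>
    show "norm (f z - T (sgn z)) \<le> B + (B + \<eta> + \<bar>T 0\<bar>)"
      using B[of z] B[of "sgn z"] T(2)[of "sgn z"] \<eta> by (cases "z = 0") (auto simp: norm_sgn)
    show "norm (f z - T (sgn z)) \<le> 2 * \<eta>" if "\<bar>cmod z - 1\<bar> < min \<delta> 1"
    proof -
      have z: "z \<noteq> 0" "cmod z \<le> 2"
        using that by auto
      have "dist z (sgn z) = \<bar>cmod z - 1\<bar>"
      proof -
        have "z - sgn z = of_real (cmod z - 1) * sgn z"
          using z by (simp add: sgn_eq left_diff_distrib diff_divide_distrib)
        then show ?thesis
          using z by (simp add: dist_norm norm_mult norm_sgn del: of_real_diff)
      qed
      then have "dist (f z) (f (sgn z)) < \<eta>"
        using that z by (intro \<delta>(2)) (auto simp: norm_sgn)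
      moreover have "\<bar>f (sgn z) - T (sgn z)\<bar> < \<eta>"
        using z by (intro T(2)) (simp add: norm_sgn)
      ultimately show ?thesis
        by (simp add: dist_real_def)
    qed
  qed (use \<eta> \<delta> in auto)
  have ev2: "eventually (\<lambda>i. dist (avg (\<lambda>z. T (sgn z)) i) (\<integral>t. T (cis t) \<partial>angle_measure) < \<eta>) sequentially"
    using avg_trig_poly[OF T(1)] \<eta> by (rule tendstoD)
  have T_int: "\<bar>(\<integral>t. T (cis t) \<partial>angle_measure) - (\<integral>t. f (cis t) \<partial>angle_measure)\<bar> \<le> \<eta>"
  proof -
    interpret prob_space angle_measure
      by (rule prob_space_angle_measure)
    have int: "integrable angle_measure (\<lambda>t. T (cis t) - f (cis t))"
      by (intro Bochner_Integration.integrable_diff integrable_continuous_cis trig_poly_continuous_on T cont')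
    have "\<bar>\<integral>t. T (cis t) - f (cis t) \<partial>angle_measure\<bar> \<le> (\<integral>t. \<bar>T (cis t) - f (cis t)\<bar> \<partial>angle_measure)"
      by (rule integral_abs_bound)
    also have "\<dots> \<le> (\<integral>t. \<eta> \<partial>angle_measure)"
    proof (intro integral_mono)
      show "\<bar>T (cis t) - f (cis t)\<bar> \<le> \<eta>" for t
        using T(2)[of "cis t"] by (simp add: abs_minus_commute less_imp_le)
    qed (use int in auto)
    finally show ?thesis
      using Bochner_Integration.integral_diff[of angle_measure "\<lambda>t. T (cis t)" "\<lambda>t. f (cis t)"]
      by (simp add: integrable_continuous_cis trig_poly_continuous_on T(1) cont' prob_space)
  qed
  from ev1 ev2 show "eventually (\<lambda>i. dist (avg f i) (\<integral>z. f z \<partial>circle_measure) < e) sequentially"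
  proof eventually_elim
    case (elim i)
    then show ?case
      unfolding integral_circle_measure[OF cont] avg_diff dist_real_def real_norm_def
      using T_int \<eta>_def by linarith
  qed
qed

end

section \<open>From root averages to weak* neighbourhoods\<close>

lemma sum_mset_eq_sum_count:
  fixes f :: "'a \<Rightarrow> 'b::comm_semiring_1"
  assumes "finite S" "set_mset A \<subseteq> S"
  shows "(\<Sum>x\<in>#A. f x) = (\<Sum>x\<in>S. of_nat (count A x) * f x)"
  using assms(2)
proof (induction A)
  case (add a A)
  have "(\<Sum>x\<in>S. of_nat (count (add_mset a A) x) * f x) =
      (\<Sum>x\<in>S. of_nat (count A x) * f x + (if x = a then f x else 0))"
    by (intro sum.cong) (auto simp: algebra_simps)
  also have "\<dots> = (\<Sum>x\<in>S. of_nat (count A x) * f x) + f a"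
    using add.prems assms(1) by (simp add: sum.distrib sum.delta)
  finally show ?case
    using add by (simp add: add.commute)
qed simp

lemma integral_zero_counting_measure:
  fixes f :: "complex \<Rightarrow> real"
  assumes "continuous_on UNIV f"
  shows "(\<integral>z. f z \<partial>zero_counting_measure n p) = (\<Sum>z\<in>#proots p. f z) / real n"
proof (cases "p = 0")
  case True
  then show ?thesis
    by (simp add: zero_counting_measure_def)
next
  case False
  let ?R = "{z. poly p z = 0}"
  have fin: "finite ?R"
    using False by (rule poly_roots_finite)
  have f: "f \<in> borel_measurable borel"
    using assms by (rule borel_measurable_continuous_onI)
  have "(\<integral>z. f z \<partial>zero_counting_measure n p) =
      (\<integral>z. f z \<partial>point_measure ?R (\<lambda>z. ennreal (real (order z p) / real n)))"
    using False f by (simp add: zero_counting_measure_def integral_distr measurable_def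
        sets_point_measure space_point_measure)
  also have "\<dots> = (\<Sum>z\<in>?R. (real (order z p) / real n) * f z)"
    using lebesgue_integral_point_measure_finite[OF fin, of "\<lambda>z. real (order z p) / real n" f] by simp
  also have "\<dots> = (\<Sum>z\<in>?R. real (count (proots p) z) * f z) / real n"
    using False by (simp add: sum_divide_distrib)
  also have "(\<Sum>z\<in>?R. real (count (proots p) z) * f z) = (\<Sum>z\<in>#proots p. f z)"
    using False by (intro sum_mset_eq_sum_count[symmetric] fin) auto
  finally show ?thesis .
qed

lemma flat_sequence_eventually_in_open:
  assumes "flat_sequence N p" "openin weak_star_topology U" "circle_measure \<in> U"
  shows "eventually (\<lambda>i. zero_counting_measure (N i) (p i) \<in> U) sequentially"
proof -
  interpret flat_sequence N p
    by fact
  let ?B = "{{\<mu> \<in> finite_borel_measures. (\<integral>x. f x \<partial>\<mu>) \<in> V} | (f :: complex \<Rightarrow> real) V.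
        continuous_on UNIV f \<and> bounded (range f) \<and> open V}"
  have "generate_topology_on ?B U"
    using assms(2) unfolding weak_star_topology_def by (rule openin_topology_generated_by)
  then show ?thesis
    using assms(3)
  proof induction
    case (Int A B)
    then show ?case
      by (simp add: eventually_conj_iff)
  next
    case (UN K)
    then obtain A where "A \<in> K" "circle_measure \<in> A"
      by blast
    then have "eventually (\<lambda>i. zero_counting_measure (N i) (p i) \<in> A) sequentially"
      using UN by blast
    then show ?case
      by eventually_elim (use \<open>A \<in> K\<close> in blast)
  next
    case (Basis A)
    have "\<exists>(f :: complex \<Rightarrow> real) V. A = {\<mu> \<in> finite_borel_measures. (\<integral>x. f x \<partial>\<mu>) \<in> V} \<and>
        continuous_on UNIV f \<and> bounded (range f) \<and> open V"
      using Basis.hyps by (rule CollectD)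
    then obtain f :: "complex \<Rightarrow> real" and V where A: "A = {\<mu> \<in> finite_borel_measures. (\<integral>x. f x \<partial>\<mu>) \<in> V}"
      and f: "continuous_on UNIV f" "bounded (range f)" and V: "open V"
      by (elim exE conjE)
    have "eventually (\<lambda>i. avg f i \<in> V) sequentially"
      using Basis.prems A by (intro topological_tendstoD[OF avg_tendsto_circle_measure[OF f] V]) simp
    moreover have "zero_counting_measure n p \<in> finite_borel_measures" for n p
      using zero_counting_measure_in_topspace topspace_weak_star by blast
    ultimately show ?case
      by (simp add: A integral_zero_counting_measure[OF f(1)] avg_def)
  qed simp
qed

lemma flat_mono:
  assumes "flat \<epsilon> n p" "\<epsilon> \<le> \<epsilon>'"
  shows "flat \<epsilon>' n p"
proof -
  have e: "\<epsilon> * n \<le> \<epsilon>' * n"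
    using assms(2) by (intro mult_right_mono) auto
  then have "exp (\<epsilon> * n) \<le> exp (\<epsilon>' * n)" "exp (-(\<epsilon>' * n)) \<le> exp (-(\<epsilon> * n))"
    by auto
  then show ?thesis
    using assms(1) e unfolding flat_def by (blast intro: order_trans)
qed

text \<open>The probabilistic argument needs \<epsilon> and n0 independent of the polynomial. If no
  pair worked, the failures for \<epsilon> = 1/(i+1) and n0 = i would form a flat sequence with all
  its measures outside U.\<close>

lemma flat_imp_in_open:
  assumes "openin weak_star_topology U" "circle_measure \<in> U"
  shows "\<exists>\<epsilon>>0. \<exists>n0. \<forall>n\<ge>n0. \<forall>p. flat \<epsilon> n p \<longrightarrow> zero_counting_measure n p \<in> U"
proof (rule ccontr)
  assume *: "\<not> ?thesis"
  have "\<exists>n p. i \<le> n \<and> flat (1 / real (Suc i)) n p \<and> zero_counting_measure n p \<notin> U" for i :: nat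
    using * by (metis of_nat_0_less_iff zero_less_Suc zero_less_divide_1_iff)
  then obtain N p where Np: "\<And>i. i \<le> N i" "\<And>i. flat (1 / real (Suc i)) (N i) (p i)"
      "\<And>i. zero_counting_measure (N i) (p i) \<notin> U"
    by metis
  have "flat_sequence N p"
  proof
    show "filterlim N at_top sequentially"
      using filterlim_ident by (rule filterlim_at_top_mono) (auto simp: Np)
    fix \<epsilon> :: real assume "\<epsilon> > 0"
    moreover have "(\<lambda>i. 1 / real (Suc i)) \<longlonglongrightarrow> 0"
      by real_asymp
    ultimately have "eventually (\<lambda>i. 1 / real (Suc i) < \<epsilon>) sequentially"
      by (intro order_tendstoD)
    then show "eventually (\<lambda>i. flat \<epsilon> (N i) (p i)) sequentially"
      by eventually_elim (auto intro: flat_mono[OF Np(2)])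
  qed
  then have "eventually (\<lambda>i. zero_counting_measure (N i) (p i) \<in> U) sequentially"
    using assms by (rule flat_sequence_eventually_in_open)
  with Np(3) show False
    by simp
qed

section \<open>Continuity of roots and measurability\<close>

text \<open>Roots are listed as functions on all of nat, padded with 0, so that bounded root lists
  lie in one compact product set.\<close>

lemma mset_as_function:
  assumes "size A = d"
  shows "\<exists>w. A = image_mset w (mset_set {..<d}) \<and> (\<forall>j\<ge>d. w j = (0 :: 'a::zero))"
proof -
  obtain xs where xs: "mset xs = A"
    using ex_mset by blast
  then have len: "length xs = d"
    using assms by auto
  define w where "w = (\<lambda>j. if j < d then xs ! j else 0)"
  have "xs = map w [0..<d]"
    using len by (intro nth_equalityI) (auto simp: w_def)
  then have "A = image_mset w (mset [0..<d])"
    using xs by (metis mset_map)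
  then show ?thesis
    by (intro exI[of _ w]) (auto simp: w_def lessThan_atLeast0)
qed

text \<open>The bound is continuous in the coefficients while the leading one is nonzero, so along a
  convergent sequence of fixed degree the roots stay in one disc.\<close>

lemma root_norm_le:
  fixes p :: "complex poly"
  assumes "p \<noteq> 0" "poly p z = 0"
  shows "cmod z \<le> 1 + (\<Sum>j<degree p. cmod (coeff p j)) / cmod (lead_coeff p)"
proof (cases "cmod z \<le> 1")
  case True
  then show ?thesis
    by (simp add: add_increasing2 sum_nonneg)
next
  case False
  let ?d = "degree p"
  have d: "?d > 0"
    using assms by (metis gr0I degree_0_id poly_0 poly_const_conv pCons_0_0)
  have "lead_coeff p * z ^ ?d = - (\<Sum>j<?d. coeff p j * z ^ j)"
    using assms(2) unfolding poly_altdef lessThan_Suc_atMost[symmetric]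
    by (simp add: eq_neg_iff_add_eq_0 add.commute)
  then have "cmod (lead_coeff p) * cmod z ^ ?d = cmod (\<Sum>j<?d. coeff p j * z ^ j)"
    by (metis norm_minus_cancel norm_mult norm_power)
  also have "\<dots> \<le> (\<Sum>j<?d. cmod (coeff p j) * cmod z ^ (?d - 1))"
    using False by (intro sum_norm_le) (auto simp: norm_mult norm_power intro!: mult_left_mono power_increasing)
  also have "\<dots> = (\<Sum>j<?d. cmod (coeff p j)) * cmod z ^ (?d - 1)"
    by (simp add: sum_distrib_right)
  finally have "cmod (lead_coeff p) * cmod z * cmod z ^ (?d - 1) \<le> (\<Sum>j<?d. cmod (coeff p j)) * cmod z ^ (?d - 1)"
    using d by (cases ?d) (auto simp: mult_ac)
  moreover have "0 < cmod z ^ (?d - 1)"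
    using False by (intro zero_less_power) auto
  ultimately have "cmod (lead_coeff p) * cmod z \<le> (\<Sum>j<?d. cmod (coeff p j))"
    by (simp only: mult_le_cancel_right_pos)
  then have "cmod z \<le> (\<Sum>j<?d. cmod (coeff p j)) / cmod (lead_coeff p)"
    using assms(1) by (simp add: pos_le_divide_eq mult.commute)
  then show ?thesis
    by simp
qed

text \<open>If the claim failed, a subsequence would stay at distance e. Its root lists lie in a
  compact set, so along a further subsequence they converge to some l. Passing to the limit in the
  factorization shows that l lists the roots of q, whence the sums converge after all. The common
  degree prevents roots from escaping to infinity.\<close>

lemma sum_proots_tendsto:
  fixes f :: "complex \<Rightarrow> real"
  assumes q: "q \<noteq> 0" and deg: "\<And>i. degree (p i) = degree q" "\<And>i. p i \<noteq> 0"
    and lim: "\<And>j. (\<lambda>i. coeff (p i) j) \<longlonglongrightarrow> coeff q j"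
    and f: "continuous_on UNIV f"
  shows "(\<lambda>i. \<Sum>z\<in>#proots (p i). f z) \<longlonglongrightarrow> (\<Sum>z\<in>#proots q. f z)"
proof (rule ccontr)
  let ?d = "degree q"
  define b where "b = (\<lambda>i. 1 + (\<Sum>j<?d. cmod (coeff (p i) j)) / cmod (coeff (p i) ?d))"
  define R where "R = 1 + (\<Sum>j<?d. cmod (coeff q j)) / cmod (coeff q ?d) + 1"
  have "b \<longlonglongrightarrow> 1 + (\<Sum>j<?d. cmod (coeff q j)) / cmod (coeff q ?d)"
    unfolding b_def using q by (intro tendsto_intros lim) auto
  then have bR: "eventually (\<lambda>i. b i < R) sequentially"
    by (rule order_tendstoD) (simp add: R_def)
  assume "\<not> ?thesis"
  then obtain e where e: "e > 0"
      "\<not> eventually (\<lambda>i. dist (\<Sum>z\<in>#proots (p i). f z) (\<Sum>z\<in>#proots q. f z) < e) sequentially"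
    by (auto simp: tendsto_iff)
  \<comment> \<open>The bound on b is put into the predicate so that a single extraction yields both
    the root bound and the distance e.\<close>
  have "\<not> eventually (\<lambda>i. b i < R \<longrightarrow> dist (\<Sum>z\<in>#proots (p i). f z) (\<Sum>z\<in>#proots q. f z) < e) sequentially"
  proof
    assume "eventually (\<lambda>i. b i < R \<longrightarrow> dist (\<Sum>z\<in>#proots (p i). f z) (\<Sum>z\<in>#proots q. f z) < e) sequentially"
    from eventually_mp[OF this bR] e(2) show False
      by simp
  qed
  from not_eventually_sequentiallyD[OF this] obtain r :: "nat \<Rightarrow> nat" where r: "strict_mono r"
    and *: "\<forall>i. \<not> (b (r i) < R \<longrightarrow> dist (\<Sum>z\<in>#proots (p (r i)). f z) (\<Sum>z\<in>#proots q. f z) < e)"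
    by (elim exE conjE)
  have bound: "b (r i) < R" and far: "\<not> dist (\<Sum>z\<in>#proots (p (r i)). f z) (\<Sum>z\<in>#proots q. f z) < e" for i
    using spec[OF *, of i] by auto
  have "\<forall>i. \<exists>w. proots (p (r i)) = image_mset w (mset_set {..<?d}) \<and> (\<forall>j\<ge>?d. w j = 0)"
    using mset_as_function[of "proots (p (r _))" ?d] by (simp add: size_proots_complex deg)
  then obtain w where w: "\<And>i. proots (p (r i)) = image_mset (w i) (mset_set {..<?d})" "\<And>i j. j \<ge> ?d \<Longrightarrow> w i j = 0"
    by metis
  let ?K = "PiE UNIV (\<lambda>j. if j < ?d then cball (0::complex) R else {0}) :: (nat \<Rightarrow> complex) set"
  have "compactin (product_topology (\<lambda>i. euclidean) UNIV) ?K"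
    unfolding compactin_PiE by auto
  then have "seq_compact ?K"
    by (simp add: euclidean_product_topology compact_imp_seq_compact)
  moreover have wK: "\<forall>i. w i \<in> ?K"
  proof
    fix i
    have "cmod (w i j) \<le> R" if "j < ?d" for j
    proof -
      have "w i j \<in># proots (p (r i))"
        using that by (simp add: w(1))
      then have "cmod (w i j) \<le> b (r i)"
        using root_norm_le[of "p (r i)" "w i j"] deg by (simp add: b_def)
      with bound[of i] show ?thesis
        by simp
    qed
    with w(2) show "w i \<in> ?K"
      by (auto simp: PiE_def Pi_def)
  qed
  ultimately obtain l s where s: "strict_mono s" "(w \<circ> s) \<longlonglongrightarrow> l"
    unfolding seq_compact_def by metis
  have wl: "(\<lambda>i. w (s i) j) \<longlonglongrightarrow> l j" for j
    using continuous_on_tendsto_compose[OF continuous_on_product_coordinates[of j] s(2)] by simp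
  have rs: "filterlim (\<lambda>i. r (s i)) sequentially sequentially"
    using filterlim_compose[OF filterlim_subseq[OF r] filterlim_subseq[OF s(1)]] .
  have sum_w: "(\<Sum>z\<in>#image_mset v (mset_set {..<?d}). g z) = (\<Sum>j<?d. g (v j))"
    for v :: "nat \<Rightarrow> complex" and g :: "complex \<Rightarrow> real"
    by (simp add: sum_unfold_sum_mset image_mset.compositionality o_def)
  have prod_w: "(\<Prod>z\<in>#image_mset v (mset_set {..<?d}). [:-z, 1:]) = (\<Prod>j<?d. [:- v j, 1:])"
    for v :: "nat \<Rightarrow> complex"
    by (simp add: prod_unfold_prod_mset image_mset.compositionality o_def)
  have "q = smult (lead_coeff q) (\<Prod>j<?d. [:- l j, 1:])"
  proof -
    have "poly q x = lead_coeff q * (\<Prod>j<?d. x - l j)" for x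
    proof (rule LIMSEQ_unique)
      have "(\<lambda>i. \<Sum>k\<le>?d. coeff (p (r (s i))) k * x ^ k) \<longlonglongrightarrow> (\<Sum>k\<le>?d. coeff q k * x ^ k)"
        by (intro tendsto_intros filterlim_compose[OF lim rs])
      then show "(\<lambda>i. poly (p (r (s i))) x) \<longlonglongrightarrow> poly q x"
        by (simp add: poly_altdef deg)
      have "poly (p (r i)) x = coeff (p (r i)) ?d * (\<Prod>j<?d. x - w i j)" for i
      proof -
        have "p (r i) = smult (lead_coeff (p (r i))) (\<Prod>z\<in>#proots (p (r i)). [:-z, 1:])"
          by (simp add: complex_poly_decompose_multiset)
        also have "\<dots> = smult (coeff (p (r i)) ?d) (\<Prod>j<?d. [:- w i j, 1:])"
          unfolding w(1) prod_w deg ..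
        finally have "poly (p (r i)) x = poly (smult (coeff (p (r i)) ?d) (\<Prod>j<?d. [:- w i j, 1:])) x"
          by (rule arg_cong)
        then show ?thesis
          by (simp add: poly_prod)
      qed
      then show "(\<lambda>i. poly (p (r (s i))) x) \<longlonglongrightarrow> lead_coeff q * (\<Prod>j<?d. x - l j)"
        by (simp only:) (intro tendsto_intros filterlim_compose[OF lim rs] wl)
    qed
    then have "poly q = poly (smult (lead_coeff q) (\<Prod>j<?d. [:- l j, 1:]))"
      by (simp add: fun_eq_iff poly_prod)
    then show ?thesis
      by (simp only: poly_eq_poly_eq_iff)
  qed
  then have "proots q = proots (smult (lead_coeff q) (\<Prod>j<?d. [:- l j, 1:]))"
    by (rule arg_cong)
  also have "\<dots> = image_mset l (mset_set {..<?d})"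
    using q by (subst proots_smult) (simp_all add: proots_prod sum_unfold_sum_mset)
  finally have "(\<Sum>z\<in>#proots q. f z) = (\<Sum>j<?d. f (l j))"
    by (simp only: sum_w)
  moreover have "(\<lambda>i. \<Sum>j<?d. f (w (s i) j)) \<longlonglongrightarrow> (\<Sum>j<?d. f (l j))"
    by (intro tendsto_sum continuous_on_tendsto_compose[OF f wl]) auto
  moreover have "(\<Sum>z\<in>#proots (p (r i)). f z) = (\<Sum>j<?d. f (w i j))" for i
    by (simp only: w(1) sum_w)
  ultimately have "(\<lambda>i. \<Sum>z\<in>#proots (p (r (s i))). f z) \<longlonglongrightarrow> (\<Sum>z\<in>#proots q. f z)"
    by (simp only:)
  from tendstoD[OF this e(1)] far show False
    by simp
qed

text \<open>The random polynomial as a function of its coefficient sequence, which turns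
  measurability into a Borel question on the product space.\<close>

definition coeff_poly :: "nat \<Rightarrow> (nat \<Rightarrow> complex) \<Rightarrow> complex poly" where
  "coeff_poly n a = (\<Sum>j\<le>n. monom (a j) j)"

lemma coeff_coeff_poly: "coeff (coeff_poly n a) j = (if j \<le> n then a j else 0)"
  by (simp add: coeff_poly_def coeff_sum)

lemma random_poly_eq: "random_poly \<xi> n \<omega> = coeff_poly n (\<lambda>j. \<xi> j \<omega>)"
  by (simp add: random_poly_def coeff_poly_def)

lemma degree_coeff_poly_le: "degree (coeff_poly n a) \<le> n"
  by (rule degree_le) (simp add: coeff_coeff_poly)

text \<open>An open condition intersected with a closed one, hence Borel. Coordinates beyond n are
  left free, since \<open>coeff_poly n\<close> does not read them.\<close>

definition degree_stratum :: "nat \<Rightarrow> nat \<Rightarrow> (nat \<Rightarrow> complex) set" where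
  "degree_stratum n d = {a. a d \<noteq> 0} \<inter> (\<Inter>j\<in>{d<..n}. {a. a j = 0})"

lemma degree_stratum:
  assumes "a \<in> degree_stratum n d" "d \<le> n"
  shows "coeff_poly n a \<noteq> 0" "degree (coeff_poly n a) = d"
proof -
  have "coeff (coeff_poly n a) d \<noteq> 0"
    using assms by (auto simp: degree_stratum_def coeff_coeff_poly)
  moreover have "degree (coeff_poly n a) \<le> d"
    using assms by (intro degree_le) (auto simp: degree_stratum_def coeff_coeff_poly)
  ultimately show "coeff_poly n a \<noteq> 0" "degree (coeff_poly n a) = d"
    by (auto intro: antisym le_degree)
qed

lemma degree_stratum_cover: "coeff_poly n a = 0 \<or> (\<exists>d\<le>n. a \<in> degree_stratum n d)"
proof (cases "coeff_poly n a = 0")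
  case False
  let ?d = "degree (coeff_poly n a)"
  have "?d \<le> n"
    by (rule degree_coeff_poly_le)
  moreover have "a ?d \<noteq> 0"
    using False \<open>?d \<le> n\<close> coeff_coeff_poly[of n a ?d] by (metis leading_coeff_0_iff)
  moreover have "a j = 0" if "j \<in> {?d<..n}" for j
    using that coeff_eq_0[of "coeff_poly n a" j] by (simp add: coeff_coeff_poly)
  ultimately show ?thesis
    by (auto simp: degree_stratum_def)
qed simp

lemma degree_stratum_borel: "degree_stratum n d \<in> sets borel"
proof -
  have "open {a. a d \<noteq> (0::complex)}"
    by (intro open_Collect_neq continuous_on_product_coordinates continuous_on_const)
  moreover have "closed (\<Inter>j\<in>{d<..n}. {a. a j = (0::complex)})"
    by (intro closed_INT ballI closed_Collect_eq continuous_on_product_coordinates continuous_on_const)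
  ultimately show ?thesis
    unfolding degree_stratum_def by (intro sets.Int borel_open borel_closed)
qed

lemma continuous_on_sum_proots:
  fixes f :: "complex \<Rightarrow> real"
  assumes f: "continuous_on UNIV f" and d: "d \<le> n"
  shows "continuous_on (degree_stratum n d) (\<lambda>a. \<Sum>z\<in>#proots (coeff_poly n a). f z)"
  unfolding continuous_on_sequentially
proof (intro allI ballI impI)
  fix x a assume a: "a \<in> degree_stratum n d"
    and x: "(\<forall>i. x i \<in> degree_stratum n d) \<and> x \<longlonglongrightarrow> a"
  have "(\<lambda>i. \<Sum>z\<in>#proots (coeff_poly n (x i)). f z) \<longlonglongrightarrow> (\<Sum>z\<in>#proots (coeff_poly n a). f z)"
  proof (rule sum_proots_tendsto[OF _ _ _ _ f])
    fix j
    have "(\<lambda>i. x i j) \<longlonglongrightarrow> a j"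
      using continuous_on_tendsto_compose[OF continuous_on_product_coordinates[of j], of x a] x by simp
    then show "(\<lambda>i. coeff (coeff_poly n (x i)) j) \<longlonglongrightarrow> coeff (coeff_poly n a) j"
      by (simp add: coeff_coeff_poly)
    show "degree (coeff_poly n (x i)) = degree (coeff_poly n a)" "coeff_poly n (x i) \<noteq> 0" for i
      using degree_stratum[OF _ d] a x by auto
  qed (use degree_stratum[OF a d] in auto)
  then show "((\<lambda>a. \<Sum>z\<in>#proots (coeff_poly n a). f z) \<circ> x) \<longlonglongrightarrow> (\<Sum>z\<in>#proots (coeff_poly n a). f z)"
    by (simp add: o_def)
qed

lemma continuous_map_zero_counting_measure:
  assumes d: "d \<le> n"
  shows "continuous_map (top_of_set (degree_stratum n d)) weak_star_topology
           (\<lambda>a. zero_counting_measure n (coeff_poly n a))"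
  unfolding weak_star_topology_def continuous_on_generated_topo_iff
proof (intro conjI allI impI)
  let ?B = "{{\<mu> \<in> finite_borel_measures. (\<integral>x. f x \<partial>\<mu>) \<in> V} | (f :: complex \<Rightarrow> real) V.
        continuous_on UNIV f \<and> bounded (range f) \<and> open V}"
  let ?Z = "\<lambda>a. zero_counting_measure n (coeff_poly n a)"
  have fin: "?Z a \<in> finite_borel_measures" for a
    using zero_counting_measure_in_topspace topspace_weak_star by blast
  show "?Z ` topspace (top_of_set (degree_stratum n d)) \<subseteq> \<Union> ?B"
    using fin by (simp add: image_subset_iff topspace_weak_star[unfolded weak_star_topology_def topology_generated_by_topspace])
  fix A assume "A \<in> ?B"
  then have "\<exists>(f :: complex \<Rightarrow> real) V. A = {\<mu> \<in> finite_borel_measures. (\<integral>x. f x \<partial>\<mu>) \<in> V} \<and>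
        continuous_on UNIV f \<and> bounded (range f) \<and> open V"
    by (rule CollectD)
  then obtain f :: "complex \<Rightarrow> real" and V where A: "A = {\<mu> \<in> finite_borel_measures. (\<integral>x. f x \<partial>\<mu>) \<in> V}"
    and f: "continuous_on UNIV f" and V: "open V"
    by (elim exE conjE)
  let ?I = "\<lambda>a. (\<Sum>z\<in>#proots (coeff_poly n a). f z) / real n"
  have "continuous_on (degree_stratum n d) ?I"
    unfolding divide_inverse using continuous_on_sum_proots[OF f d] by (rule continuous_on_mult_right)
  then have "openin (top_of_set (degree_stratum n d)) (degree_stratum n d \<inter> ?I -` V)"
    using V by (rule continuous_openin_preimage_gen)
  moreover have "?Z -` A \<inter> topspace (top_of_set (degree_stratum n d)) = degree_stratum n d \<inter> ?I -` V"
    using fin by (auto simp: A integral_zero_counting_measure[OF f])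
  ultimately show "openin (top_of_set (degree_stratum n d)) (?Z -` A \<inter> topspace (top_of_set (degree_stratum n d)))"
    by (simp only:)
qed

text \<open>An arbitrary weak* open set may be an uncountable union of basic ones, so measurability does not
  follow from that of the integrals. It holds because the zeros depend continuously on the
  coefficients as long as the degree is fixed.\<close>

lemma borel_zero_counting_measure_in_open:
  assumes "openin weak_star_topology U"
  shows "{a. zero_counting_measure n (coeff_poly n a) \<in> U} \<in> sets borel"
proof -
  let ?Z = "\<lambda>a. zero_counting_measure n (coeff_poly n a)"
  have stratum: "{a \<in> degree_stratum n d. ?Z a \<in> U} \<in> sets borel" if d: "d \<le> n" for d
  proof -
    have "openin (top_of_set (degree_stratum n d)) {a \<in> degree_stratum n d. ?Z a \<in> U}"
      using openin_continuous_map_preimage[OF continuous_map_zero_counting_measure[OF d] assms] by simp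
    then obtain T where "open T" "{a \<in> degree_stratum n d. ?Z a \<in> U} = degree_stratum n d \<inter> T"
      by (auto simp: openin_open)
    then show ?thesis
      by (auto intro!: sets.Int degree_stratum_borel)
  qed
  have zero: "{a. coeff_poly n a = 0} \<in> sets borel"
  proof -
    have "{a. coeff_poly n a = 0} = (\<Inter>j\<in>{..n}. {a. a j = (0::complex)})"
      by (auto simp: poly_eq_iff coeff_coeff_poly)
    moreover have "closed (\<Inter>j\<in>{..n}. {a. a j = (0::complex)})"
      by (intro closed_INT ballI closed_Collect_eq continuous_on_product_coordinates continuous_on_const)
    ultimately show ?thesis
      by (simp only: borel_closed)
  qed
  \<comment> \<open>The zero polynomial lies in no stratum with d <= n; there the measure is
    constant, so this part is the whole zero set or empty.\<close>
  have "{a. ?Z a \<in> U} = (\<Union>d\<in>{..n}. {a \<in> degree_stratum n d. ?Z a \<in> U}) \<union>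
      (if zero_counting_measure n 0 \<in> U then {a. coeff_poly n a = 0} else {})"
    (is "_ = ?V")
  proof (rule set_eqI)
    fix a
    show "a \<in> {a. ?Z a \<in> U} \<longleftrightarrow> a \<in> ?V"
    proof (cases "coeff_poly n a = 0")
      case True
      then have "a \<notin> degree_stratum n d" if "d \<le> n" for d
        using degree_stratum(1)[OF _ that] by blast
      with True show ?thesis
        by auto
    next
      case False
      then show ?thesis
        using degree_stratum_cover[of n a] by auto
    qed
  qed
  moreover have "(\<Union>d\<in>{..n}. {a \<in> degree_stratum n d. ?Z a \<in> U}) \<in> sets borel"
    using stratum by (intro sets.finite_UN) auto
  ultimately show ?thesis
    using zero by (auto intro!: sets.Un)
qed

lemma measurable_zero_counting_measure_in_open:
  assumes "\<And>j. \<xi> j \<in> borel_measurable M" "openin weak_star_topology U"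
  shows "{\<omega> \<in> space M. zero_counting_measure n (random_poly \<xi> n \<omega>) \<in> U} \<in> sets M"
proof -
  have "(\<lambda>\<omega> j. \<xi> j \<omega>) \<in> borel_measurable M"
    using assms(1) by (rule measurable_coordinatewise_then_product)
  from measurable_sets[OF this borel_zero_counting_measure_in_open[OF assms(2), of n]]
  show ?thesis
    by (simp add: vimage_def random_poly_eq Int_def conj_commute)
qed

section \<open>The tail condition implies convergence\<close>

locale iid_sequence = prob_space M for M :: "'w measure" +
  fixes \<xi> :: "nat \<Rightarrow> 'w \<Rightarrow> complex"
  assumes indep: "indep_vars (\<lambda>_. borel) \<xi> UNIV"
    and ident: "distr M borel (\<xi> j) = distr M borel (\<xi> 0)"
begin

lemma \<xi>_measurable [measurable]: "\<xi> j \<in> borel_measurable M"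
  using indep by (simp add: indep_vars_def)

lemma prob_eq:
  assumes "A \<in> sets borel"
  shows "prob {\<omega> \<in> space M. \<xi> j \<omega> \<in> A} = prob {\<omega> \<in> space M. \<xi> 0 \<omega> \<in> A}"
proof -
  have "prob {\<omega> \<in> space M. \<xi> i \<omega> \<in> A} = measure (distr M borel (\<xi> i)) A" for i
    using assms by (simp add: measure_distr vimage_def Int_def conj_commute)
  then show ?thesis
    by (simp only: ident[of j])
qed

text \<open>The sets may vary with the index, as the two thresholds in \<open>prob_late_jump\<close>
  require.\<close>

lemma prob_all:
  assumes "finite J" "\<And>j. j \<in> J \<Longrightarrow> A j \<in> sets borel"
  shows "prob {\<omega> \<in> space M. \<forall>j\<in>J. \<xi> j \<omega> \<in> A j} = (\<Prod>j\<in>J. prob {\<omega> \<in> space M. \<xi> 0 \<omega> \<in> A j})"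
proof (cases "J = {}")
  case False
  have "{\<omega> \<in> space M. \<forall>j\<in>J. \<xi> j \<omega> \<in> A j} = (\<Inter>j\<in>J. \<xi> j -` A j \<inter> space M)"
    using False by auto
  then have "prob {\<omega> \<in> space M. \<forall>j\<in>J. \<xi> j \<omega> \<in> A j} = (\<Prod>j\<in>J. prob (\<xi> j -` A j \<inter> space M))"
    using indep_varsD[OF indep False assms(1)] assms(2) by simp
  also have "\<dots> = (\<Prod>j\<in>J. prob {\<omega> \<in> space M. \<xi> 0 \<omega> \<in> A j})"
  proof (rule prod.cong)
    fix j assume "j \<in> J"
    have "\<xi> j -` A j \<inter> space M = {\<omega> \<in> space M. \<xi> j \<omega> \<in> A j}"
      by auto
    then show "prob (\<xi> j -` A j \<inter> space M) = prob {\<omega> \<in> space M. \<xi> 0 \<omega> \<in> A j}"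
      using prob_eq[OF assms(2)[OF \<open>j \<in> J\<close>], of j] by (simp only:)
  qed simp
  finally show ?thesis .
qed (simp add: prob_space)

definition tail :: "real \<Rightarrow> real" where
  "tail t = prob {\<omega> \<in> space M. exp t < cmod (\<xi> 0 \<omega>)}"

lemma tail_nonneg: "0 \<le> tail t" and tail_le_1: "tail t \<le> 1"
  by (simp_all add: tail_def)

lemma tail_antimono: "s \<le> t \<Longrightarrow> tail t \<le> tail s"
  unfolding tail_def by (intro finite_measure_mono) (auto intro: le_less_trans[of "exp s" "exp t"])

lemma prob_norm_le: "prob {\<omega> \<in> space M. cmod (\<xi> 0 \<omega>) \<le> exp t} = 1 - tail t"
proof -
  have "{\<omega> \<in> space M. cmod (\<xi> 0 \<omega>) \<le> exp t} = space M - {\<omega> \<in> space M. exp t < cmod (\<xi> 0 \<omega>)}"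
    by auto
  then show ?thesis
    by (simp add: tail_def prob_compl)
qed

lemma tail_small:
  assumes "e > 0"
  shows "\<exists>T. tail T < e"
proof -
  let ?A = "\<lambda>k::nat. {\<omega> \<in> space M. exp (real k) < cmod (\<xi> 0 \<omega>)}"
  have "(\<lambda>k. prob (?A k)) \<longlonglongrightarrow> prob (\<Inter>k. ?A k)"
  proof (rule finite_Lim_measure_decseq)
    show "decseq ?A"
      unfolding decseq_def by (fastforce intro: le_less_trans[rotated])
  qed auto
  moreover have "(\<Inter>k. ?A k) = {}"
  proof -
    have "\<not> exp (real k) < x" if "x \<le> real k" for k and x :: real
      using that exp_ge_add_one_self[of "real k"] by linarith
    then have "\<exists>k::nat. \<not> exp (real k) < x" for x :: real
      using real_arch_simple[of x] by blast
    then show ?thesis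
      by blast
  qed
  ultimately have "eventually (\<lambda>k. prob (?A k) < e) sequentially"
    using assms by (intro order_tendstoD(2)) auto
  then obtain k where "prob (?A k) < e"
    by (auto simp: eventually_sequentially)
  then show ?thesis
    by (auto simp: tail_def)
qed

lemma prob_max_le: "prob {\<omega> \<in> space M. \<exists>j\<in>{..n}. exp t < cmod (\<xi> j \<omega>)} \<le> (real n + 1) * tail t"
proof -
  have "{\<omega> \<in> space M. \<exists>j\<in>{..n}. exp t < cmod (\<xi> j \<omega>)} = (\<Union>j\<in>{..n}. {\<omega> \<in> space M. exp t < cmod (\<xi> j \<omega>)})"
    by auto
  then have "prob {\<omega> \<in> space M. \<exists>j\<in>{..n}. exp t < cmod (\<xi> j \<omega>)} \<le>
      (\<Sum>j\<in>{..n}. prob {\<omega> \<in> space M. exp t < cmod (\<xi> j \<omega>)})"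
    by (simp only:) (intro finite_measure_subadditive_finite, auto)
  also have "\<dots> = (\<Sum>j\<in>{..n}. tail t)"
  proof (rule sum.cong)
    show "prob {\<omega> \<in> space M. exp t < cmod (\<xi> j \<omega>)} = tail t" for j
      using prob_eq[of "{z. exp t < cmod z}" j] unfolding tail_def mem_Collect_eq by simp
  qed simp
  finally show ?thesis
    by (simp add: add.commute)
qed

lemma prob_all_small:
  assumes "finite J"
  shows "prob {\<omega> \<in> space M. \<forall>j\<in>J. cmod (\<xi> j \<omega>) < a} = (1 - prob {\<omega> \<in> space M. a \<le> cmod (\<xi> 0 \<omega>)}) ^ card J"
proof -
  have "{\<omega> \<in> space M. cmod (\<xi> 0 \<omega>) < a} = space M - {\<omega> \<in> space M. a \<le> cmod (\<xi> 0 \<omega>)}"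
    by auto
  then have "prob {\<omega> \<in> space M. cmod (\<xi> 0 \<omega>) < a} = 1 - prob {\<omega> \<in> space M. a \<le> cmod (\<xi> 0 \<omega>)}"
    by (simp add: prob_compl)
  then show ?thesis
    using prob_all[OF assms, of "\<lambda>_. {z. cmod z < a}"] by simp
qed

lemma flat_random_poly:
  assumes "\<And>j. j \<le> n \<Longrightarrow> cmod (\<xi> j \<omega>) \<le> exp (\<epsilon> * n)"
    and "exp (-(\<epsilon> * n)) \<le> a" "m \<le> n" "real m \<le> \<epsilon> * n"
    and "k \<le> m" "a \<le> cmod (\<xi> k \<omega>)" "n - m \<le> l" "l \<le> n" "a \<le> cmod (\<xi> l \<omega>)"
  shows "flat \<epsilon> n (random_poly \<xi> n \<omega>)"
proof -
  have c: "coeff (random_poly \<xi> n \<omega>) j = (if j \<le> n then \<xi> j \<omega> else 0)" for j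
    by (simp add: random_poly_eq coeff_coeff_poly)
  have "cmod (coeff (random_poly \<xi> n \<omega>) j) \<le> exp (\<epsilon> * n)" for j
    using assms(1) by (simp add: c)
  moreover have "real k \<le> \<epsilon> * n" "exp (-(\<epsilon> * n)) \<le> cmod (coeff (random_poly \<xi> n \<omega>) k)"
    using assms by (auto simp: c)
  moreover have "real n - real l \<le> \<epsilon> * n" "exp (-(\<epsilon> * n)) \<le> cmod (coeff (random_poly \<xi> n \<omega>) l)"
    using assms by (auto simp: c)
  moreover have "degree (random_poly \<xi> n \<omega>) \<le> n"
    by (simp add: random_poly_eq degree_coeff_poly_le)
  ultimately show ?thesis
    unfolding flat_def by blast
qed

text \<open>Flatness fails only if some coefficient exceeds exp (\<epsilon> n), or all coefficients
  in a window of length m + 1 at one of the two ends are below a. The first event has probability at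
  most (n + 1) tail (\<epsilon> n), which vanishes by the tail condition; each of the others has
  probability q^(m + 1) with q < 1 and m of order \<epsilon> n.\<close>

lemma converges_if_tail_small:
  assumes a: "a > 0" "prob {\<omega> \<in> space M. a \<le> cmod (\<xi> 0 \<omega>)} > 0"
    and tail: "((\<lambda>t. tail t * t) \<longlongrightarrow> 0) at_top"
    and U: "openin weak_star_topology U" "circle_measure \<in> U"
  shows "(\<lambda>n. prob {\<omega> \<in> space M. zero_counting_measure n (random_poly \<xi> n \<omega>) \<in> U}) \<longlonglongrightarrow> 1"
proof -
  obtain \<epsilon>0 n0 where \<epsilon>0: "\<epsilon>0 > 0"
      "\<And>n p. n \<ge> n0 \<Longrightarrow> flat \<epsilon>0 n p \<Longrightarrow> zero_counting_measure n p \<in> U"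
    using flat_imp_in_open[OF U] by blast
  \<comment> \<open>The cap at 1 gives m n <= n, so both windows lie inside {0..n}.\<close>
  define \<epsilon> where "\<epsilon> = min \<epsilon>0 1"
  have \<epsilon>: "\<epsilon> > 0" "\<epsilon> \<le> 1" "\<And>n p. n \<ge> n0 \<Longrightarrow> flat \<epsilon> n p \<Longrightarrow> zero_counting_measure n p \<in> U"
    using \<epsilon>0 flat_mono[of \<epsilon> _ _ \<epsilon>0] by (auto simp: \<epsilon>_def)
  define q where "q = 1 - prob {\<omega> \<in> space M. a \<le> cmod (\<xi> 0 \<omega>)}"
  have q: "0 \<le> q" "q < 1"
    using a(2) by (auto simp: q_def)
  define m where "m = (\<lambda>n. nat \<lfloor>\<epsilon> * real n\<rfloor>)"
  have m: "real (m n) \<le> \<epsilon> * n" "m n \<le> n" for n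
  proof -
    show *: "real (m n) \<le> \<epsilon> * n"
      using \<epsilon>(1) by (simp add: m_def)
    have "\<epsilon> * real n \<le> 1 * real n"
      using \<epsilon>(2) by (intro mult_right_mono) auto
    with * show "m n \<le> n"
      by linarith
  qed
  define b where "b = (\<lambda>n. (real n + 1) * tail (\<epsilon> * n) + 2 * q ^ (m n + 1))"
  have "b \<longlonglongrightarrow> 0"
  proof -
    have lin: "filterlim (\<lambda>n::nat. \<epsilon> * real n) at_top sequentially"
      using \<epsilon>(1) by (intro filterlim_tendsto_pos_mult_at_top[OF tendsto_const]) (auto intro: filterlim_real_sequentially)
    have "(\<lambda>n. (real n + 1) / (\<epsilon> * real n)) \<longlonglongrightarrow> 1 / \<epsilon>"
      using \<epsilon>(1) by real_asymp (simp add: field_simps)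
    then have "(\<lambda>n. (real n + 1) / (\<epsilon> * real n) * (tail (\<epsilon> * n) * (\<epsilon> * n))) \<longlonglongrightarrow> 1 / \<epsilon> * 0"
      by (intro tendsto_mult filterlim_compose[OF tail lin])
    moreover have "eventually (\<lambda>n. (real n + 1) / (\<epsilon> * real n) * (tail (\<epsilon> * n) * (\<epsilon> * n)) =
        (real n + 1) * tail (\<epsilon> * n)) sequentially"
      using eventually_gt_at_top[of 0] by eventually_elim (use \<epsilon>(1) in simp)
    ultimately have "(\<lambda>n. (real n + 1) * tail (\<epsilon> * n)) \<longlonglongrightarrow> 0"
      by (simp add: tendsto_cong)
    moreover have "filterlim m at_top sequentially"
      unfolding m_def using filterlim_compose[OF filterlim_nat_sequentially filterlim_compose[OF filterlim_floor_sequentially lin]] .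
    then have "filterlim (\<lambda>n. m n + 1) at_top sequentially"
      by (rule filterlim_at_top_mono) simp
    then have "(\<lambda>n. q ^ (m n + 1)) \<longlonglongrightarrow> 0"
      using q by (intro filterlim_compose[OF LIMSEQ_power_zero[of q]]) auto
    ultimately have "b \<longlonglongrightarrow> 0 + 2 * 0"
      unfolding b_def by (intro tendsto_intros)
    then show ?thesis
      by simp
  qed
  have "eventually (\<lambda>n. exp (-(\<epsilon> * real n)) < a) sequentially"
  proof (rule order_tendstoD)
    show "(\<lambda>n. exp (-(\<epsilon> * real n))) \<longlonglongrightarrow> 0"
      using \<epsilon>(1) by real_asymp
  qed (use a in auto)
  then have lower: "eventually (\<lambda>n. 1 - b n \<le>
      prob {\<omega> \<in> space M. zero_counting_measure n (random_poly \<xi> n \<omega>) \<in> U}) sequentially"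
    using eventually_ge_at_top[of n0]
  proof eventually_elim
    case (elim n)
    let ?G = "{\<omega> \<in> space M. zero_counting_measure n (random_poly \<xi> n \<omega>) \<in> U}"
    let ?B1 = "{\<omega> \<in> space M. \<exists>j\<in>{..n}. exp (\<epsilon> * n) < cmod (\<xi> j \<omega>)}"
    let ?B2 = "{\<omega> \<in> space M. \<forall>j\<in>{..m n}. cmod (\<xi> j \<omega>) < a}"
    let ?B3 = "{\<omega> \<in> space M. \<forall>j\<in>{n - m n..n}. cmod (\<xi> j \<omega>) < a}"
    have G: "?G \<in> events"
      using U(1) by (intro measurable_zero_counting_measure_in_open) auto
    have sub: "space M \<subseteq> ?G \<union> (?B1 \<union> (?B2 \<union> ?B3))"
    proof
      fix \<omega> assume \<omega>: "\<omega> \<in> space M"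
      show "\<omega> \<in> ?G \<union> (?B1 \<union> (?B2 \<union> ?B3))"
      proof (cases "\<omega> \<in> ?B1 \<union> (?B2 \<union> ?B3)")
        case False
        then have 1: "cmod (\<xi> j \<omega>) \<le> exp (\<epsilon> * n)" if "j \<le> n" for j
          using \<omega> that by (auto simp: not_less)
        obtain k where k: "k \<le> m n" "a \<le> cmod (\<xi> k \<omega>)"
          using False \<omega> by (auto simp: not_less)
        obtain l where l: "n - m n \<le> l" "l \<le> n" "a \<le> cmod (\<xi> l \<omega>)"
          using False \<omega> by (auto simp: not_less)
        have "flat \<epsilon> n (random_poly \<xi> n \<omega>)"
          by (rule flat_random_poly[OF 1 _ m(2) m(1) k l]) (use elim in auto)
        with \<epsilon>(3) elim \<omega> show ?thesis
          by auto
      qed auto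
    qed
    have "1 = prob (space M)"
      by (simp add: prob_space)
    also have "\<dots> \<le> prob (?G \<union> (?B1 \<union> (?B2 \<union> ?B3)))"
      using G by (intro finite_measure_mono[OF sub] sets.Un) auto
    also have "\<dots> \<le> prob ?G + (prob ?B1 + (prob ?B2 + prob ?B3))"
      using G by (intro order_trans[OF measure_Un_le] add_left_mono sets.Un) auto
    also have "prob ?B1 \<le> (real n + 1) * tail (\<epsilon> * n)"
      by (rule prob_max_le)
    also have "prob ?B2 = q ^ (m n + 1)"
      by (simp add: prob_all_small q_def)
    also have "prob ?B3 = q ^ (m n + 1)"
      using m(2)[of n] by (simp add: prob_all_small q_def)
    finally show ?case
      by (simp add: b_def)
  qed
  have lim: "(\<lambda>n. 1 - b n) \<longlonglongrightarrow> 1"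
    using tendsto_diff[OF tendsto_const[of 1] \<open>b \<longlonglongrightarrow> 0\<close>] by simp
  show ?thesis
    by (rule tendsto_sandwich[OF lower _ lim tendsto_const]) simp
qed

end

section \<open>Failure of the tail condition prevents convergence\<close>

text \<open>No regular variation of the tail is assumed. If \<open>p (t/2) > 4 p t\<close> at every scale, then halving \<open>t\<close>
  repeatedly at least doubles \<open>t * p t\<close> until it contradicts \<open>p \<le> 1\<close>.\<close>

lemma regular_scale_exists:
  fixes p :: "real \<Rightarrow> real"
  assumes c: "c > 0" and p: "\<And>t. p t \<le> 1" and inf: "\<And>T. \<exists>t\<ge>T. c < t * p t"
  shows "\<exists>t\<ge>T. c < t * p t \<and> p (t / 2) \<le> 4 * p t"
proof (rule ccontr)
  assume neg: "\<not> ?thesis"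
  define S where "S = max T 1"
  have S: "S \<ge> 1"
    by (simp add: S_def)
  have step: "4 * p t < p (t / 2)" if "S \<le> t" "c < t * p t" for t
    using neg that by (force simp: S_def)
  \<comment> \<open>As t * p t only grows under halving, it stays above c, so \<open>step\<close>
    remains applicable down to scale S.\<close>
  have iter: "c * 2 ^ k < (t / 2 ^ k) * p (t / 2 ^ k)" if "S * 2 ^ k \<le> t" "c < t * p t" for k t
    using that(1)
  proof (induction k)
    case (Suc k)
    let ?s = "t / 2 ^ k"
    have "S * 2 ^ k \<le> S * 2 ^ Suc k"
      using S by simp
    then have IH: "c * 2 ^ k < ?s * p ?s"
      using Suc by linarith
    have s: "S \<le> ?s"
      using \<open>S * 2 ^ k \<le> S * 2 ^ Suc k\<close> Suc.prems by (simp add: pos_le_divide_eq del: power_Suc)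
    have "c * 1 \<le> c * 2 ^ k"
      using c by (intro mult_left_mono) auto
    then have "4 * p ?s < p (?s / 2)"
      using s IH by (intro step) auto
    then have "?s / 2 * (4 * p ?s) < ?s / 2 * p (?s / 2)"
      using s S by (intro mult_strict_left_mono) auto
    then have "2 * (?s * p ?s) < ?s / 2 * p (?s / 2)"
      by simp
    with IH have "2 * (c * 2 ^ k) < ?s / 2 * p (?s / 2)"
      by linarith
    then show ?case
      by (simp add: mult_ac)
  qed (use that in simp)
  \<comment> \<open>With k maximal such that S 2^k <= t, the scale reached is below 2S, so p <= 1
    gives c 2^k < 2S. But t >= 4 S^2 / c and t < S 2^(k+1) give c 2^k > 2S.\<close>
  obtain t where t: "max S (4 * S\<^sup>2 / c) \<le> t" "c < t * p t"
    using inf by blast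
  obtain k where k: "S * 2 ^ k \<le> t" "t < S * 2 ^ Suc k"
  proof -
    define k where "k = nat \<lfloor>log 2 (t / S)\<rfloor>"
    have "0 \<le> log 2 (t / S)"
      using t S by (simp add: zero_le_log_cancel_iff)
    then have "real k \<le> log 2 (t / S)" "log 2 (t / S) < real (Suc k)"
      unfolding k_def by linarith+
    then have "2 powr real k \<le> t / S" "t / S < 2 powr real (Suc k)"
      using t S by (simp_all add: le_log_iff log_less_iff del: of_nat_Suc)
    then have "2 ^ k \<le> t / S" "t / S < 2 ^ Suc k"
      by (simp_all only: powr_realpow zero_less_numeral)
    then show ?thesis
      using S that[of k] by (simp add: field_simps)
  qed
  have "c * 2 ^ k < (t / 2 ^ k) * p (t / 2 ^ k)"
    using k(1) t(2) by (rule iter)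
  also have "\<dots> \<le> (t / 2 ^ k) * 1"
    using p t S by (intro mult_left_mono divide_nonneg_nonneg) auto
  also have "\<dots> < 2 * S"
    using k(2) by (simp add: pos_divide_less_eq mult_ac)
  finally have "c * 2 ^ k * (2 * S) < 2 * S * (2 * S)"
    using S by (intro mult_strict_right_mono) auto
  moreover have "c * t < c * (S * 2 ^ Suc k)"
    using c k(2) by (rule mult_strict_left_mono[rotated])
  moreover have "4 * S\<^sup>2 \<le> c * t"
    using t(1) c by (simp add: pos_divide_le_eq mult.commute)
  ultimately show False
    by (simp add: power2_eq_square mult_ac)
qed

text \<open>If the number k of small roots were below m, all coefficients up to and including index
  k would be at most exp (t/2), and \<open>coeff_le_low_coeffs\<close> would give exp t < 24^n (k +
  1) exp (t/2) <= 48^n exp (t/2). As 48 <= exp 10, this contradicts t >= 20 n; that is the origin of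
  the constant 20.\<close>

lemma many_small_roots:
  assumes p: "degree p \<le> n" and m: "m \<le> n" and t: "20 * real n \<le> t"
    and low: "\<And>j. j < m \<Longrightarrow> cmod (coeff p j) \<le> exp (t / 2)"
    and high: "exp t < cmod (coeff p j)"
  shows "m \<le> size {#z \<in># proots p. cmod z < 1/2#}"
proof (rule ccontr)
  let ?k = "size {#z \<in># proots p. cmod z < 1/2#}"
  assume "\<not> m \<le> ?k"
  then have k: "?k < m" "?k < n"
    using m by auto
  have "p \<noteq> 0"
    using high less_trans[OF exp_gt_zero[of t] high] by auto
  have "exp t < 24 ^ n * (\<Sum>i\<le>?k. cmod (coeff p i))"
    using high coeff_le_low_coeffs[OF \<open>p \<noteq> 0\<close> p, of j] by simp
  also have "\<dots> \<le> 24 ^ n * (\<Sum>i\<le>?k. exp (t / 2))"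
    using k low by (intro mult_left_mono sum_mono) auto
  also have "\<dots> = 24 ^ n * ((real ?k + 1) * exp (t / 2))"
    by (simp add: add.commute)
  also have "\<dots> \<le> 24 ^ n * (2 ^ n * exp (t / 2))"
  proof (intro mult_left_mono mult_right_mono)
    have "real (?k + 1) \<le> real (2 ^ n)"
      using k(2) less_exp[of n] by (intro of_nat_mono) linarith
    then show "real ?k + 1 \<le> 2 ^ n"
      by simp
  qed auto
  also have "\<dots> = 48 ^ n * exp (t / 2)"
    by (simp flip: power_mult_distrib mult.assoc)
  finally have "exp (t / 2) * exp (t / 2) < 48 ^ n * exp (t / 2)"
    by (simp flip: exp_add)
  then have "exp (t / 2) < 48 ^ n"
    by simp
  also have "(48::real) ^ n \<le> exp 10 ^ n"
  proof (rule power_mono)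
    have "(3::real) ^ 5 \<le> exp 2 ^ 5"
      using exp_ge_add_one_self[of 2] by (intro power_mono) auto
    also have "exp 2 ^ 5 = exp (10::real)"
      by (simp flip: exp_of_nat_mult)
    finally show "(48::real) \<le> exp 10"
      by simp
  qed simp
  also have "exp 10 ^ n \<le> exp (t / 2)"
    using t by (simp flip: exp_of_nat_mult)
  finally show False
    by simp
qed

text \<open>A continuous stand-in for the indicator of |z| < 1/2 that vanishes on the unit circle,
  so the limit measure gives it integral 0.\<close>

definition disc_bump :: "complex \<Rightarrow> real" where
  "disc_bump z = max 0 (min 1 (2 - 2 * cmod z))"

lemma disc_bump:
  "continuous_on UNIV disc_bump" "bounded (range disc_bump)"
  "0 \<le> disc_bump z" "cmod z < 1/2 \<Longrightarrow> disc_bump z = 1" "cmod z = 1 \<Longrightarrow> disc_bump z = 0"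
proof -
  show "continuous_on UNIV disc_bump"
    unfolding disc_bump_def by (intro continuous_intros)
  show "bounded (range disc_bump)"
    unfolding bounded_iff by (intro exI[of _ 1]) (auto simp: disc_bump_def)
qed (auto simp: disc_bump_def)

text \<open>The threshold 1/3 is chosen because n div 2 >= n/3 for n >= 3: half of the roots in |z|
  < 1/2 already leave this neighbourhood.\<close>

definition few_small_zeros :: "complex measure set" where
  "few_small_zeros = {\<mu> \<in> finite_borel_measures. (\<integral>z. disc_bump z \<partial>\<mu>) \<in> {..<1/3}}"

lemma few_small_zeros:
  "openin weak_star_topology few_small_zeros" "circle_measure \<in> few_small_zeros"
proof -
  show "openin weak_star_topology few_small_zeros"
    unfolding weak_star_topology_def few_small_zeros_def
  proof (intro topology_generated_by_Basis CollectI exI conjI)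
    show "open {..<1/3 :: real}"
      by simp
  qed (use disc_bump in auto)
  have "(\<integral>z. disc_bump z \<partial>circle_measure) = (\<integral>t. 0 \<partial>angle_measure)"
    unfolding integral_circle_measure[OF disc_bump(1)] by (simp add: disc_bump)
  then show "circle_measure \<in> few_small_zeros"
    using circle_measure_in_topspace by (simp add: few_small_zeros_def topspace_weak_star)
qed

lemma not_few_small_zeros:
  assumes "n div 2 \<le> size {#z \<in># proots p. cmod z < 1/2#}" "n \<ge> 3"
  shows "zero_counting_measure n p \<notin> few_small_zeros"
proof -
  have "real (size {#z \<in># A. cmod z < 1/2#}) \<le> (\<Sum>z\<in>#A. disc_bump z)" for A
  proof (induction A)
    case (add z A)
    then show ?case
      using disc_bump(3,4)[of z] by auto
  qed simp
  from this[of "proots p"] assms have "real (n div 2) \<le> (\<Sum>z\<in>#proots p. disc_bump z)"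
    by linarith
  moreover have "real n \<le> 3 * real (n div 2)"
    using assms(2) by linarith
  ultimately have "1/3 \<le> (\<Sum>z\<in>#proots p. disc_bump z) / real n"
    using assms(2) by (simp add: field_simps)
  then show ?thesis
    by (simp add: few_small_zeros_def integral_zero_counting_measure disc_bump)
qed

context iid_sequence
begin

text \<open>The event is a difference of two product events, one nested in the other: the first m
  coefficients obey the bound exp s, minus the case that the remaining n + 1 - m also obey exp t.
  Since s <= t, the jump cannot occur among the first m.\<close>

lemma prob_late_jump:
  assumes "m \<le> n" "s \<le> t"
  shows "prob {\<omega> \<in> space M. (\<forall>j<m. cmod (\<xi> j \<omega>) \<le> exp s) \<and> (\<exists>j\<le>n. exp t < cmod (\<xi> j \<omega>))}
           = (1 - tail s) ^ m * (1 - (1 - tail t) ^ (n + 1 - m))"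
proof -
  let ?r = "\<lambda>j. if j < m then s else t"
  let ?A = "{\<omega> \<in> space M. \<forall>j\<in>{..<m}. \<xi> j \<omega> \<in> {z. cmod z \<le> exp s}}"
  let ?B = "{\<omega> \<in> space M. \<forall>j\<in>{..n}. \<xi> j \<omega> \<in> {z. cmod z \<le> exp (?r j)}}"
  have "{\<omega> \<in> space M. (\<forall>j<m. cmod (\<xi> j \<omega>) \<le> exp s) \<and> (\<exists>j\<le>n. exp t < cmod (\<xi> j \<omega>))} = ?A - ?B"
    (is "?E = _")
  proof (intro equalityI subsetI)
    fix \<omega> assume "\<omega> \<in> ?E"
    then obtain j where j: "\<omega> \<in> ?A" "j \<le> n" "exp t < cmod (\<xi> j \<omega>)"
      by auto
    have "exp s \<le> exp t"
      using assms(2) by simp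
    then have "exp (?r j) \<le> exp t"
      by simp
    then have "\<xi> j \<omega> \<notin> {z. cmod z \<le> exp (?r j)}"
      using j(3) unfolding mem_Collect_eq by linarith
    then have "\<omega> \<notin> ?B"
      using j(2) by blast
    with j(1) show "\<omega> \<in> ?A - ?B"
      by blast
  next
    fix \<omega> assume \<omega>: "\<omega> \<in> ?A - ?B"
    then have A: "cmod (\<xi> j \<omega>) \<le> exp s" if "j < m" for j
      using that by simp
    obtain j where j: "j \<le> n" "\<not> cmod (\<xi> j \<omega>) \<le> exp (?r j)"
      using \<omega> by blast
    have "\<not> j < m"
    proof
      assume "j < m"
      with A[OF this] j(2) show False
        by simp
    qed
    with j have "exp t < cmod (\<xi> j \<omega>)"
      by simp
    with A j(1) \<omega> show "\<omega> \<in> ?E"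
      by blast
  qed
  moreover have "?B \<subseteq> ?A"
  proof
    fix \<omega> assume \<omega>: "\<omega> \<in> ?B"
    have "cmod (\<xi> j \<omega>) \<le> exp s" if "j < m" for j
    proof -
      have "j \<in> {..n}"
        using that assms(1) by simp
      with \<omega> have "\<xi> j \<omega> \<in> {z. cmod z \<le> exp (?r j)}"
        by blast
      with that show ?thesis
        by simp
    qed
    with \<omega> show "\<omega> \<in> ?A"
      by simp
  qed
  moreover have "?A \<in> events" "?B \<in> events"
    by measurable
  ultimately have "prob ?E = prob ?A - prob ?B"
    by (simp only: finite_measure_Diff)
  also have "prob ?A = (1 - tail s) ^ m"
    by (subst prob_all) (simp_all add: prob_norm_le)
  also have "prob ?B = (\<Prod>j\<le>n. 1 - tail (?r j))"
    by (subst prob_all) (simp_all add: prob_norm_le)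
  also have "\<dots> = (\<Prod>j<m. 1 - tail (?r j)) * (\<Prod>j\<in>{m..n}. 1 - tail (?r j))"
    using assms(1) by (subst prod.union_disjoint[symmetric]) (auto intro!: prod.cong)
  also have "\<dots> = (1 - tail s) ^ m * (1 - tail t) ^ (n + 1 - m)"
    by simp
  finally show ?thesis
    by (simp add: right_diff_distrib)
qed

text \<open>The size n is fitted to the scale t: n is about \<eta> / tail t, so the expected number
  of coefficients above exp t is of order \<eta>, and a jump in the second half has probability
  bounded below. The regularity of the scale bounds tail (t/2) by 4 tail t, so the first half stays
  below exp (t/2) with probability at least 4/5.\<close>

lemma not_converges_if_tail_large:
  assumes c: "c > 0" and inf: "\<And>T. \<exists>t\<ge>T. c < t * tail t"
  shows "\<not> (\<lambda>n. prob {\<omega> \<in> space M. zero_counting_measure n (random_poly \<xi> n \<omega>) \<in> few_small_zeros}) \<longlonglongrightarrow> 1"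
proof
  let ?P = "\<lambda>n. prob {\<omega> \<in> space M. zero_counting_measure n (random_poly \<xi> n \<omega>) \<in> few_small_zeros}"
  assume conv: "?P \<longlonglongrightarrow> 1"
  \<comment> \<open>1/10 makes the Bernoulli bound 1 - (n/2) * 4 tail t at least 1 - 2 \<eta> >=
    4/5. c/20 yields 20 n tail t <= c < t tail t, hence 20 n <= t.\<close>
  define \<eta> where "\<eta> = min (1/10) (c / 20)"
  have \<eta>: "0 < \<eta>" "\<eta> \<le> 1/10" "20 * \<eta> \<le> c"
    using c by (auto simp: \<eta>_def min_def)
  define \<kappa> where "\<kappa> = 4/5 * (1 - exp (-(\<eta> / 4)))"
  have "\<kappa> > 0"
    using \<eta>(1) by (simp add: \<kappa>_def)
  then have "eventually (\<lambda>n. 1 - \<kappa> < ?P n) sequentially"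
    by (intro order_tendstoD(1)[OF conv]) simp
  then obtain n1 where n1: "\<And>n. n \<ge> n1 \<Longrightarrow> 1 - \<kappa> < ?P n"
    by (auto simp: eventually_sequentially)
  define n2 where "n2 = max n1 3"
  \<comment> \<open>A tail this small forces \<eta> / tail t > n2 + 1, so the n derived from t is
    beyond n1 and at least 3.\<close>
  obtain T where T: "tail T < \<eta> / (real n2 + 1)"
    using tail_small[of "\<eta> / (real n2 + 1)"] \<eta>(1) by auto
  obtain t where t: "t \<ge> max T 1" "c < t * tail t" "tail (t / 2) \<le> 4 * tail t"
    using regular_scale_exists[OF c tail_le_1 inf] by blast
  have p_pos: "tail t > 0"
    using t(2) c tail_nonneg[of t] by (cases "tail t = 0") auto
  have "tail t < \<eta> / (real n2 + 1)"
    using tail_antimono[of T t] T t(1) by simp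
  then have p_n2: "tail t * (real n2 + 1) < \<eta>"
    by (simp add: pos_less_divide_eq add_pos_pos)
  define n where "n = nat \<lfloor>\<eta> / tail t\<rfloor>"
  have "0 \<le> \<eta> / tail t"
    using \<eta>(1) p_pos by simp
  then have n_le: "real n \<le> \<eta> / tail t" and n_gt: "\<eta> / tail t < real n + 1"
    unfolding n_def by linarith+
  have np: "real n * tail t \<le> \<eta>" "\<eta> < (real n + 1) * tail t"
    using n_le n_gt p_pos by (simp_all add: pos_le_divide_eq pos_divide_less_eq)
  have "real n2 + 1 < \<eta> / tail t"
    using p_n2 p_pos by (simp add: pos_less_divide_eq mult.commute)
  then have n: "n \<ge> n1" "n \<ge> 3"
    using n_gt unfolding n2_def by linarith+
  have "20 * real n * tail t \<le> t * tail t"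
    using np(1) \<eta>(3) t(2) by linarith
  then have nt: "20 * real n \<le> t"
    using p_pos by simp
  let ?m = "n div 2"
  let ?E = "{\<omega> \<in> space M. (\<forall>j<?m. cmod (\<xi> j \<omega>) \<le> exp (t / 2)) \<and> (\<exists>j\<le>n. exp t < cmod (\<xi> j \<omega>))}"
  have E: "?E \<in> events"
    by measurable
  have "\<kappa> \<le> prob ?E"
  proof -
    have "1 + real ?m * - tail (t / 2) \<le> (1 + - tail (t / 2)) ^ ?m"
      using tail_le_1[of "t / 2"] by (intro Bernoulli_inequality) auto
    moreover have "real ?m * tail (t / 2) \<le> (real n / 2) * (4 * tail t)"
      using t(3) tail_nonneg by (intro mult_mono) auto
    ultimately have 1: "4/5 \<le> (1 - tail (t / 2)) ^ ?m"
      using np(1) \<eta>(2) by simp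
    have "1 - tail t \<le> exp (- tail t)"
      using exp_ge_add_one_self[of "- tail t"] by simp
    then have "(1 - tail t) ^ (n + 1 - ?m) \<le> exp (- tail t) ^ (n + 1 - ?m)"
      using tail_le_1[of t] by (intro power_mono) auto
    also have "\<dots> = exp (- (real (n + 1 - ?m) * tail t))"
      by (simp flip: exp_of_nat_mult)
    also have "\<dots> \<le> exp (-(\<eta> / 4))"
    proof -
      have "(real n + 1) / 2 * tail t \<le> real (n + 1 - ?m) * tail t"
        using p_pos by (intro mult_right_mono) auto
      then show ?thesis
        using np(2) \<eta>(1) by simp
    qed
    finally have 2: "1 - exp (-(\<eta> / 4)) \<le> 1 - (1 - tail t) ^ (n + 1 - ?m)"
      by simp
    have "\<kappa> \<le> (1 - tail (t / 2)) ^ ?m * (1 - (1 - tail t) ^ (n + 1 - ?m))"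
      unfolding \<kappa>_def using 1 2
    proof (rule mult_mono)
      show "0 \<le> (1 - tail (t / 2)) ^ ?m"
        using 1 by linarith
    qed (use \<eta>(1) in simp)
    also have "\<dots> = prob ?E"
      using t(1) by (intro prob_late_jump[symmetric]) auto
    finally show ?thesis .
  qed
  have "?P n \<le> prob (space M - ?E)"
  proof (rule finite_measure_mono)
    show "{\<omega> \<in> space M. zero_counting_measure n (random_poly \<xi> n \<omega>) \<in> few_small_zeros} \<subseteq> space M - ?E"
    proof
      fix \<omega> assume \<omega>: "\<omega> \<in> {\<omega> \<in> space M. zero_counting_measure n (random_poly \<xi> n \<omega>) \<in> few_small_zeros}"
      have "\<omega> \<notin> ?E"
      proof
        assume "\<omega> \<in> ?E"
        then obtain j where j: "j \<le> n" "exp t < cmod (\<xi> j \<omega>)"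
          and low: "\<And>j. j < ?m \<Longrightarrow> cmod (\<xi> j \<omega>) \<le> exp (t / 2)"
          by auto
        have "?m \<le> size {#z \<in># proots (random_poly \<xi> n \<omega>). cmod z < 1/2#}"
        proof (rule many_small_roots[OF _ _ nt])
          show "exp t < cmod (coeff (random_poly \<xi> n \<omega>) j)"
            using j by (simp add: random_poly_eq coeff_coeff_poly)
        qed (use low in \<open>auto simp: random_poly_eq coeff_coeff_poly degree_coeff_poly_le\<close>)
        from not_few_small_zeros[OF this n(2)] \<omega> show False
          by simp
      qed
      with \<omega> show "\<omega> \<in> space M - ?E"
        by simp
    qed
  qed (use E in auto)
  also have "\<dots> = 1 - prob ?E"
    using E by (rule prob_compl)
  finally show False
    using n1[OF n(1)] \<open>\<kappa> \<le> prob ?E\<close> by simp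
qed

end

section \<open>Both implications together\<close>

text \<open>One of two distinct support points is some x other than 0, and the open set |z| > |x|/2
  around it has positive mass.\<close>

lemma nondegenerate_imp_not_zero:
  fixes X :: "'w \<Rightarrow> complex"
  assumes "prob_space M" and X: "X \<in> borel_measurable M" and "nondegenerate M X"
  shows "\<exists>a>0. measure M {\<omega> \<in> space M. a \<le> cmod (X \<omega>)} > 0"
proof -
  interpret prob_space M
    by fact
  obtain x where x: "x \<noteq> 0" "x \<in> measure_support (distr M borel X)"
    using assms(3) unfolding nondegenerate_def by metis
  have "{z. cmod x / 2 < cmod z} \<in> sets borel"
    by measurable
  moreover have "emeasure (distr M borel X) {z. cmod x / 2 < cmod z} > 0"
  proof -
    have "open {z. cmod x / 2 < cmod z}"
      by (intro open_Collect_less continuous_intros)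
    moreover have "x \<in> {z. cmod x / 2 < cmod z}"
      using x(1) by simp
    ultimately show ?thesis
      using x(2) unfolding measure_support_def by blast
  qed
  ultimately have "emeasure M {\<omega> \<in> space M. cmod x / 2 < cmod (X \<omega>)} > 0"
    using X by (simp add: emeasure_distr vimage_def Int_def conj_commute)
  then have "0 < prob {\<omega> \<in> space M. cmod x / 2 < cmod (X \<omega>)}"
    by (simp add: emeasure_eq_measure)
  also have "\<dots> \<le> prob {\<omega> \<in> space M. cmod x / 2 \<le> cmod (X \<omega>)}"
    using X by (intro finite_measure_mono) auto
  finally show ?thesis
    using x(1) by (intro exI[of _ "cmod x / 2"]) simp
qed

theorem theorem5p6:
  fixes M :: "'w measure" and \<xi> :: "nat \<Rightarrow> 'w \<Rightarrow> complex"
  assumes "prob_space M"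
    and indep: "prob_space.indep_vars M (\<lambda>_. borel) \<xi> UNIV"
    and ident: "\<And>j. distr M borel (\<xi> j) = distr M borel (\<xi> 0)"
    and nondeg: "\<And>j. nondegenerate M (\<xi> j)"
  shows "converges_in_prob M weak_star_topology
           (\<lambda>n \<omega>. zero_counting_measure n (random_poly \<xi> n \<omega>)) circle_measure
         \<longleftrightarrow>
         (\<lambda>t::real. measure M {\<omega> \<in> space M. cmod (\<xi> 0 \<omega>) > exp t}) \<in> o[at_top](\<lambda>t. 1 / t)"
proof -
  interpret iid_sequence M \<xi>
    using assms by (simp add: iid_sequence_def iid_sequence_axioms_def)
  obtain a where a: "a > 0" "prob {\<omega> \<in> space M. a \<le> cmod (\<xi> 0 \<omega>)} > 0"
    using nondegenerate_imp_not_zero[OF assms(1) \<xi>_measurable nondeg] by blast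
  have "converges_in_prob M weak_star_topology
      (\<lambda>n \<omega>. zero_counting_measure n (random_poly \<xi> n \<omega>)) circle_measure \<longleftrightarrow> tail \<in> o[at_top](\<lambda>t. 1 / t)"
  proof
    assume "tail \<in> o[at_top](\<lambda>t. 1 / t)"
    then have "((\<lambda>t. tail t / (1 / t)) \<longlongrightarrow> 0) at_top"
      by (rule smalloD_tendsto)
    then have "((\<lambda>t. tail t * t) \<longlongrightarrow> 0) at_top"
      by simp
    with a show "converges_in_prob M weak_star_topology
        (\<lambda>n \<omega>. zero_counting_measure n (random_poly \<xi> n \<omega>)) circle_measure"
      unfolding converges_in_prob_def by (blast intro: converges_if_tail_small)
  next
    assume conv: "converges_in_prob M weak_star_topology
        (\<lambda>n \<omega>. zero_counting_measure n (random_poly \<xi> n \<omega>)) circle_measure"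
    show "tail \<in> o[at_top](\<lambda>t. 1 / t)"
    proof (rule landau_o.smallI)
      fix c :: real assume c: "c > 0"
      \<comment> \<open>Otherwise t * tail t exceeds c at arbitrarily large t, and the neighbourhood
        \<open>few_small_zeros\<close> of the circle measure refutes convergence.\<close>
      have "\<exists>T. \<forall>t\<ge>T. t * tail t \<le> c"
        using not_converges_if_tail_large[OF c] conv few_small_zeros
        unfolding converges_in_prob_def by (meson not_le)
      then have "eventually (\<lambda>t. t * tail t \<le> c) at_top"
        by (simp add: eventually_at_top_linorder)
      then show "eventually (\<lambda>t. norm (tail t) \<le> c * norm (1 / t)) at_top"
        using eventually_gt_at_top[of 0]
        by eventually_elim (use tail_nonneg in \<open>auto simp: field_simps\<close>)
    qed
  qed
  then show ?thesis
    by (simp only: tail_def[abs_def])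
qed

end
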